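(* Let $T$ be a contraction on a complex Hilbert space $\mathcal{H}$ satisfying $|T|\le|\mathrm{Re}\,T|$. Then $$\mathcal{N}(I-T^*T)=\mathcal{N}(I-TT^* )=\mathcal{N}(I-|\mathrm{Re}\,T|)$$ and this subspace reduces $T$ to a symmetry. Also, $$\mathcal{N}(\mathrm{Re}\,T)=\mathcal{N}(T)\cap\mathcal{N}(T^* ),\qquad \mathcal{N}(T^* )=\mathcal{N}(\mathrm{Re}\,T)\oplus\mathcal{N}\big(T^*|_{\overline{\mathcal{R}(T^* )}}\big).$$ Moreover, one has $\mathcal{N}(T)=\mathcal{N}(\mathrm{Re}\,T)$ if and only if $T=U\oplus Z$ with respect to some orthogonal decomposition $\mathcal{H}=\mathcal{G}\oplus\mathcal{G}^{\perp}$, where $U$ is a symmetry (on $\mathcal{G}$) and $Z$ is a pure contraction (on $\mathcal{G}^\perp$) satisfying $|Z|\le|\mathrm{Re}\,Z|$.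
   Context: For a bounded operator $T$ on a complex Hilbert space, $|T|=(T^*T)^{1/2}$ and $\mathrm{Re}\,T=\frac12(T+T^* )$; inequalities between self-adjoint operators are in the usual (Loewner) order. $\mathcal{N}(\cdot)$ and $\mathcal{R}(\cdot)$ denote null-space and range, $I$ the identity. A contraction is an operator with $\|T\|\le1$; it is pure if $\|Tx\|<\|x\|$ for all $x\ne0$. A symmetry is a unitary operator $U$ with $U^*=U$. A closed subspace $\mathcal{G}$ reduces $T$ to a symmetry if $T\mathcal{G}\subset\mathcal{G}$, $T^*\mathcal{G}\subset\mathcal{G}$ and $T|_{\mathcal{G}}$ is a symmetry on $\mathcal{G}$. $T^*|_{\overline{\mathcal{R}(T^* )}}$ is the restriction of $T^*$ to the closure of its range. *)

theory Defs
  imports "HOL-Analysis.Analysis"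
begin

class complex_vector = real_vector +
  fixes scaleC :: "complex \<Rightarrow> 'a \<Rightarrow> 'a"  (infixr \<open>*\<^sub>C\<close> 75)
  assumes scaleC_add_right: "a *\<^sub>C (x + y) = a *\<^sub>C x + a *\<^sub>C y"
    and scaleC_add_left: "(a + b) *\<^sub>C x = a *\<^sub>C x + b *\<^sub>C x"
    and scaleC_scaleC: "a *\<^sub>C (b *\<^sub>C x) = (a * b) *\<^sub>C x"
    and scaleR_scaleC: "r *\<^sub>R x = complex_of_real r *\<^sub>C x"

text \<open>The inner product is linear in its first argument. Definiteness and positivity
  follow from the last axiom.\<close>

class complex_inner = complex_vector + real_normed_vector +
  fixes cinner :: "'a \<Rightarrow> 'a \<Rightarrow> complex"
  assumes cinner_commute: "cinner x y = cnj (cinner y x)"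
    and cinner_add_left: "cinner (x + y) z = cinner x z + cinner y z"
    and cinner_scaleC_left: "cinner (a *\<^sub>C x) y = a * cinner x y"
    and cinner_norm: "cinner x x = complex_of_real ((norm x)\<^sup>2)"

class chilbert_space = complex_inner + complete_space

instantiation complex :: chilbert_space
begin

definition scaleC_complex :: "complex \<Rightarrow> complex \<Rightarrow> complex"
  where "scaleC_complex a x = a * x"

definition cinner_complex :: "complex \<Rightarrow> complex \<Rightarrow> complex"
  where "cinner_complex x y = x * cnj y"

instance
  by standard
    (auto simp: scaleC_complex_def cinner_complex_def algebra_simps scaleR_conv_of_real
      complex_norm_square[symmetric] simp del: of_real_power)

end

definition closed_csubspace :: "'a::chilbert_space set \<Rightarrow> bool"
  where "closed_csubspace S \<longleftrightarrow>
    closed S \<and> 0 \<in> S \<and> (\<forall>x\<in>S. \<forall>y\<in>S. x + y \<in> S) \<and> (\<forall>a. \<forall>x\<in>S. a *\<^sub>C x \<in> S)"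

definition ortho :: "'a::chilbert_space set \<Rightarrow> 'a set"
  where "ortho S = {y. \<forall>x\<in>S. cinner x y = 0}"

definition orthogonal_direct_sum ::
    "'a::chilbert_space set \<Rightarrow> 'a set \<Rightarrow> 'a set \<Rightarrow> bool"
  where "orthogonal_direct_sum M A B \<longleftrightarrow>
    (\<forall>a\<in>A. \<forall>b\<in>B. cinner a b = 0) \<and> M = {a + b | a b. a \<in> A \<and> b \<in> B}"

text \<open>
  Operators on a closed subspace \<open>S\<close>, regarded as a Hilbert space in its own right, are
  represented by functions on the ambient type of which only the values on \<open>S\<close> matter.
  In particular the adjoint, the real part and the modulus below are formed inside \<open>S\<close>;
  \<open>S = UNIV\<close> gives the operators on the whole space.
\<close>

definition bounded_op_on :: "'a::chilbert_space set \<Rightarrow> ('a \<Rightarrow> 'a) \<Rightarrow> bool"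
  where "bounded_op_on S T \<longleftrightarrow>
    (\<forall>x\<in>S. T x \<in> S) \<and>
    (\<forall>x\<in>S. \<forall>y\<in>S. T (x + y) = T x + T y) \<and>
    (\<forall>a. \<forall>x\<in>S. T (a *\<^sub>C x) = a *\<^sub>C T x) \<and>
    (\<exists>K. \<forall>x\<in>S. norm (T x) \<le> K * norm x)"

definition null_on :: "'a::chilbert_space set \<Rightarrow> ('a \<Rightarrow> 'a) \<Rightarrow> 'a set"
  where "null_on S T = {x \<in> S. T x = 0}"

definition adjoint_on :: "'a::chilbert_space set \<Rightarrow> ('a \<Rightarrow> 'a) \<Rightarrow> 'a \<Rightarrow> 'a"
  where "adjoint_on S T y = (THE z. z \<in> S \<and> (\<forall>x\<in>S. cinner (T x) y = cinner x z))"

definition Re_on :: "'a::chilbert_space set \<Rightarrow> ('a \<Rightarrow> 'a) \<Rightarrow> 'a \<Rightarrow> 'a"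
  where "Re_on S T x = (1 / 2) *\<^sub>R (T x + adjoint_on S T x)"

definition positive_on :: "'a::chilbert_space set \<Rightarrow> ('a \<Rightarrow> 'a) \<Rightarrow> bool"
  where "positive_on S A \<longleftrightarrow>
    bounded_op_on S A \<and>
    (\<forall>x\<in>S. Im (cinner (A x) x) = 0 \<and> 0 \<le> Re (cinner (A x) x))"

definition loewner_le_on :: "'a::chilbert_space set \<Rightarrow> ('a \<Rightarrow> 'a) \<Rightarrow> ('a \<Rightarrow> 'a) \<Rightarrow> bool"
  where "loewner_le_on S A B \<longleftrightarrow> positive_on S (\<lambda>x. B x - A x)"

text \<open>The value \<open>0\<close> outside \<open>S\<close> makes the positive square root unique as a function.\<close>

definition sqrt_on :: "'a::chilbert_space set \<Rightarrow> ('a \<Rightarrow> 'a) \<Rightarrow> 'a \<Rightarrow> 'a"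
  where "sqrt_on S A =
    (THE B. positive_on S B \<and> (\<forall>x\<in>S. B (B x) = A x) \<and> (\<forall>x. x \<notin> S \<longrightarrow> B x = 0))"

definition abs_on :: "'a::chilbert_space set \<Rightarrow> ('a \<Rightarrow> 'a) \<Rightarrow> 'a \<Rightarrow> 'a"
  where "abs_on S T = sqrt_on S (\<lambda>x. adjoint_on S T (T x))"

text \<open>As for \<^const>\<open>onorm\<close>, the quotient is \<open>0\<close> at \<open>x = 0\<close>.\<close>

definition onorm_on :: "'a::chilbert_space set \<Rightarrow> ('a \<Rightarrow> 'a) \<Rightarrow> real"
  where "onorm_on S T = (SUP x\<in>S. norm (T x) / norm x)"

definition contraction_on :: "'a::chilbert_space set \<Rightarrow> ('a \<Rightarrow> 'a) \<Rightarrow> bool"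
  where "contraction_on S T \<longleftrightarrow> bounded_op_on S T \<and> onorm_on S T \<le> 1"

definition pure_contraction_on :: "'a::chilbert_space set \<Rightarrow> ('a \<Rightarrow> 'a) \<Rightarrow> bool"
  where "pure_contraction_on S T \<longleftrightarrow>
    contraction_on S T \<and> (\<forall>x\<in>S. x \<noteq> 0 \<longrightarrow> norm (T x) < norm x)"

definition unitary_on :: "'a::chilbert_space set \<Rightarrow> ('a \<Rightarrow> 'a) \<Rightarrow> bool"
  where "unitary_on S U \<longleftrightarrow>
    bounded_op_on S U \<and>
    (\<forall>x\<in>S. adjoint_on S U (U x) = x \<and> U (adjoint_on S U x) = x)"

definition symmetry_on :: "'a::chilbert_space set \<Rightarrow> ('a \<Rightarrow> 'a) \<Rightarrow> bool"
  where "symmetry_on S U \<longleftrightarrow> unitary_on S U \<and> (\<forall>x\<in>S. adjoint_on S U x = U x)"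

definition reduces_to_symmetry :: "'a::chilbert_space set \<Rightarrow> ('a \<Rightarrow> 'a) \<Rightarrow> bool"
  where "reduces_to_symmetry G T \<longleftrightarrow>
    closed_csubspace G \<and> T ` G \<subseteq> G \<and> adjoint_on UNIV T ` G \<subseteq> G \<and> symmetry_on G T"

text \<open>\<open>T = U \<oplus> Z\<close> with respect to the orthogonal decomposition of the whole space
  into \<open>G\<close> and \<open>ortho G\<close>.\<close>

definition is_op_direct_sum ::
    "('a::chilbert_space \<Rightarrow> 'a) \<Rightarrow> 'a set \<Rightarrow> ('a \<Rightarrow> 'a) \<Rightarrow> ('a \<Rightarrow> 'a) \<Rightarrow> bool"
  where "is_op_direct_sum T G U Z \<longleftrightarrow>
    orthogonal_direct_sum UNIV G (ortho G) \<and>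
    (\<forall>x\<in>G. \<forall>y\<in>ortho G. T (x + y) = U x + Z y)"

end

theory Submission
  imports Defs
begin

text \<open>
  The hypothesis \<open>|T| \<le> |Re T|\<close> already forces \<open>T = T*\<close>, after which every
  claim is elementary. Write \<open>T = A + B\<close> with \<open>A\<close> self-adjoint and \<open>B\<close> skew,
  \<open>C = |A|\<close> and \<open>M = |A| - |T| \<ge> 0\<close>; comparing \<open>T*T\<close> with \<open>(C - M)\<^sup>2\<close> gives
  \<open>-B\<^sup>2 + [A,B] = M\<^sup>2 - CM - MC\<close>. Suppose \<open>\<parallel>A\<parallel> \<le> r\<close>. On the spectral subspace of \<open>A\<close> for
  \<open>[3r/4, r]\<close> one has \<open>A = C\<close>, and \<open>M\<^sup>2 \<le> rM\<close>, so the compression of \<open>CM + MC - M\<^sup>2\<close> is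
  positive up to a Lyapunov averaging. Averaging \<open>B\<close> in the same way gives a skew operator \<open>K\<close>
  whose commutator with a bounded self-adjoint operator dominates \<open>K*K\<close>; testing on approximate
  eigenvectors for \<open>\<parallel>K\<parallel>\<close> shows \<open>K = 0\<close>, and hence \<open>B\<close> vanishes on this spectral subspace and,
  by symmetry, on that for \<open>[-r, -3r/4]\<close>. On the orthogonal complement of the largest
  \<open>A\<close>-invariant subspace annihilated by \<open>B\<close> the norm bound \<open>r\<close> thus improves to \<open>3r/4\<close>, so by
  iteration \<open>A = 0\<close> there, and then \<open>T = 0\<close> and \<open>B = 0\<close> there as well.
\<close>

section \<open>The real inner product and Riesz representation\<close>

instance chilbert_space \<subseteq> banach ..

text \<open>With the real part of the inner product the space is a real Hilbert space. The whole
  operator argument is real; complex scalars return at the end through \<open>ii_op\<close>.\<close>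

definition rinner :: "'a::chilbert_space \<Rightarrow> 'a \<Rightarrow> real"  (infixl \<open>\<bullet>\<^sub>R\<close> 70)
  where "x \<bullet>\<^sub>R y = Re (cinner x y)"

lemma rinner_self: "x \<bullet>\<^sub>R x = (norm x)\<^sup>2"
  by (simp add: rinner_def cinner_norm)

lemma rinner_commute: "x \<bullet>\<^sub>R y = y \<bullet>\<^sub>R x"
  unfolding rinner_def by (subst cinner_commute) simp

lemma rinner_add_left: "(x + y) \<bullet>\<^sub>R z = x \<bullet>\<^sub>R z + y \<bullet>\<^sub>R z"
  by (simp add: rinner_def cinner_add_left)

lemma rinner_add_right: "z \<bullet>\<^sub>R (x + y) = z \<bullet>\<^sub>R x + z \<bullet>\<^sub>R y"
  by (metis rinner_add_left rinner_commute)

lemma rinner_scaleR_left: "(a *\<^sub>R x) \<bullet>\<^sub>R y = a *\<^sub>R (x \<bullet>\<^sub>R y)"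
  by (simp add: rinner_def scaleR_scaleC cinner_scaleC_left)

lemma rinner_scaleR_right: "y \<bullet>\<^sub>R (a *\<^sub>R x) = a *\<^sub>R (y \<bullet>\<^sub>R x)"
  by (metis rinner_scaleR_left rinner_commute)

lemma abs_rinner_le: "\<bar>x \<bullet>\<^sub>R y\<bar> \<le> norm x * norm y"
proof -
  have exp: "(norm (x + y))\<^sup>2 = (norm x)\<^sup>2 + 2 * (x \<bullet>\<^sub>R y) + (norm y)\<^sup>2" for x y :: 'a
    by (simp flip: rinner_self add: rinner_add_left rinner_add_right rinner_commute)
  have le: "x \<bullet>\<^sub>R y \<le> norm x * norm y" for x y :: 'a
  proof -
    have "(norm (x + y))\<^sup>2 \<le> (norm x + norm y)\<^sup>2"
      by (intro power_mono norm_triangle_ineq) simp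
    then show ?thesis by (simp add: exp power2_sum)
  qed
  have "(-1) *\<^sub>R (x \<bullet>\<^sub>R y) \<le> norm x * norm y"
    using le[of "(-1) *\<^sub>R x" y] by (simp only: rinner_scaleR_left) simp
  with le[of x y] show ?thesis by simp
qed

interpretation rinner: bounded_bilinear rinner
  by standard
    (auto simp: rinner_add_left rinner_add_right rinner_scaleR_left rinner_scaleR_right
      intro!: exI[of _ 1] abs_rinner_le)

lemmas rinner_simps = rinner.add_left rinner.add_right rinner.diff_left rinner.diff_right
  rinner.minus_left rinner.minus_right rinner_scaleR_left rinner_scaleR_right

declare rinner.zero_left [simp] rinner.zero_right [simp]

lemma norm_add_sq: "(norm (x + y))\<^sup>2 = (norm x)\<^sup>2 + 2 * (x \<bullet>\<^sub>R y) + (norm y)\<^sup>2"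
  for x y :: "'a::chilbert_space"
  by (simp flip: rinner_self add: rinner_simps rinner_commute)

lemma norm_diff_sq: "(norm (x - y))\<^sup>2 = (norm x)\<^sup>2 - 2 * (x \<bullet>\<^sub>R y) + (norm y)\<^sup>2"
  for x y :: "'a::chilbert_space"
  using norm_add_sq[of x "- y"] by (simp add: rinner_simps)

lemma rinner_ext: "(\<And>z. z \<bullet>\<^sub>R x = z \<bullet>\<^sub>R y) \<Longrightarrow> x = y"
  by (metis eq_iff_diff_eq_0 norm_eq_zero power_eq_0_iff rinner.diff_right rinner_self)

lemma nonneg_quadratic_imp_zero:
  fixes a b :: real
  assumes "\<And>t. 0 \<le> 2 * t * b + t\<^sup>2 * a"
  shows "b = 0"
proof (rule ccontr)
  assume b: "b \<noteq> 0"
  \<comment> \<open>The positive bound \<open>s\<close> replaces \<open>a\<close>, so that the test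
    value \<open>t = - b / s\<close> makes sense whatever the sign of \<open>a\<close>.\<close>
  define s where "s = \<bar>a\<bar> + 1"
  have s: "s > 0" "a \<le> s" by (auto simp: s_def)
  have "0 \<le> 2 * (- b / s) * b + (- b / s)\<^sup>2 * a" by (rule assms)
  also have "\<dots> \<le> 2 * (- b / s) * b + (- b / s)\<^sup>2 * s"
    using s by (intro add_left_mono mult_left_mono) auto
  also have "\<dots> = - (b\<^sup>2 / s)" using s by (simp add: field_simps power2_eq_square)
  also have "\<dots> < 0" using s b by simp
  finally show False by simp
qed

text \<open>Direct method: the representer minimises |z|^2 - 2 f z over \<open>S\<close>. Allowing a
  subspace yields adjoints (\<open>S = UNIV\<close>) and orthogonal projections from one
  result.\<close>

lemma riesz_representation_on:
  fixes f :: "'a::chilbert_space \<Rightarrow> real"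
  assumes S: "subspace S" "closed S" and f: "bounded_linear f"
  obtains z where "z \<in> S" "\<And>x. x \<in> S \<Longrightarrow> f x = x \<bullet>\<^sub>R z"
proof -
  interpret f: bounded_linear f by fact
  obtain K where K: "\<And>x. \<bar>f x\<bar> \<le> norm x * K" using f.bounded by auto
  define J where "J z = (norm z)\<^sup>2 - 2 * f z" for z
  have J_ge: "- K\<^sup>2 \<le> J z" for z
  proof -
    have "0 \<le> (norm z - K)\<^sup>2" by simp
    then show ?thesis using K[of z] unfolding J_def power2_diff by (auto simp: algebra_simps)
  qed
  define m where "m = (INF z\<in>S. J z)"
  have ne: "S \<noteq> {}" using S(1) subspace_0 by auto
  have bdd: "bdd_below (J ` S)" using J_ge by (intro bdd_belowI2)
  have m_le: "m \<le> J z" if "z \<in> S" for z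
    unfolding m_def using bdd that by (rule cINF_lower)
  have "\<exists>z\<in>S. J z < m + inverse (Suc n)" for n
  proof -
    have "m < m + inverse (Suc n)" by simp
    then show ?thesis unfolding m_def
      using cINF_less_iff[OF ne bdd] by blast
  qed
  then obtain z where zS: "\<And>n. z n \<in> S" and z: "\<And>n::nat. J (z n) < m + inverse (Suc n)"
    by metis
  \<comment> \<open>Parallelogram law: the left side is 2 J u + 2 J v - 4 J((u + v)/2), and the
    midpoint lies in \<open>S\<close>. Hence minimising sequences are Cauchy.\<close>
  have par: "(norm (u - v))\<^sup>2 \<le> 2 * (J u - m) + 2 * (J v - m)" if "u \<in> S" "v \<in> S" for u v
  proof -
    have "(1/2) *\<^sub>R (u + v) \<in> S" using that S by (simp add: subspace_add subspace_scale)
    from m_le[OF this] show ?thesis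
      unfolding J_def by (simp add: norm_diff_sq norm_add_sq rinner_simps f.scaleR f.add power_mult_distrib field_simps)
  qed
  have "Cauchy z"
  proof (rule metric_CauchyI)
    fix e :: real assume e: "0 < e"
    then obtain N :: nat where N: "inverse (Suc N) < e\<^sup>2 / 4"
      using reals_Archimedean[of "e\<^sup>2 / 4"] by auto
    have small: "J (z n) - m < e\<^sup>2 / 4" if "n \<ge> N" for n
    proof -
      have "inverse (real (Suc n)) \<le> inverse (real (Suc N))" using that by simp
      then show ?thesis using z[of n] N by linarith
    qed
    have "dist (z a) (z b) < e" if "a \<ge> N" "b \<ge> N" for a b
    proof -
      have "(norm (z a - z b))\<^sup>2 < e\<^sup>2"
        using par[OF zS[of a] zS[of b]] small[OF that(1)] small[OF that(2)] by argo
      then show ?thesis using e by (simp add: dist_norm power_less_imp_less_base)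
    qed
    then show "\<exists>M. \<forall>a\<ge>M. \<forall>b\<ge>M. dist (z a) (z b) < e" by blast
  qed
  then obtain l where l: "z \<longlonglongrightarrow> l" using Cauchy_convergent convergent_def by blast
  have lS: "l \<in> S" using S(2) zS l closed_sequentially by blast
  have "(\<lambda>n. J (z n)) \<longlonglongrightarrow> J l"
    unfolding J_def by (intro tendsto_intros l f.tendsto)
  moreover have "(\<lambda>n. m + inverse (real (Suc n))) \<longlonglongrightarrow> m + 0"
    by (intro tendsto_intros LIMSEQ_inverse_real_of_nat)
  ultimately have "J l \<le> m + 0"
    using z by (intro LIMSEQ_le[of "\<lambda>n. J (z n)"]) (auto intro: less_imp_le)
  \<comment> \<open>First variation at the minimiser \<open>l\<close> in the direction
    \<open>x\<close>.\<close>
  have "x \<bullet>\<^sub>R l - f x = 0" if x: "x \<in> S" for x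
  proof (rule nonneg_quadratic_imp_zero)
    fix t :: real
    have "l + t *\<^sub>R x \<in> S" using S x lS by (simp add: subspace_add subspace_scale)
    from m_le[OF this] \<open>J l \<le> m + 0\<close>
    show "0 \<le> 2 * t * (x \<bullet>\<^sub>R l - f x) + t\<^sup>2 * (norm x)\<^sup>2"
      unfolding J_def
      by (simp add: norm_add_sq f.add f.scaleR rinner_simps rinner_commute[of l] power_mult_distrib algebra_simps)
  qed
  then show ?thesis using that lS by force
qed

section \<open>Adjoints, projections, and self-adjoint, skew and positive operators\<close>

definition is_adjoint :: "('a::chilbert_space \<Rightarrow>\<^sub>L 'a) \<Rightarrow> ('a \<Rightarrow>\<^sub>L 'a) \<Rightarrow> bool"
  where "is_adjoint T S \<longleftrightarrow> (\<forall>x y. T x \<bullet>\<^sub>R y = x \<bullet>\<^sub>R S y)"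

lemma is_adjoint_exists:
  fixes T :: "'a::chilbert_space \<Rightarrow>\<^sub>L 'a"
  obtains S where "is_adjoint T S"
proof -
  have "\<exists>z. \<forall>x. T x \<bullet>\<^sub>R y = x \<bullet>\<^sub>R z" for y
  proof -
    have "bounded_linear (\<lambda>x. T x \<bullet>\<^sub>R y)"
      by (intro bounded_linear_compose[OF rinner.bounded_linear_left]) (rule blinfun.bounded_linear_right)
    from riesz_representation_on[OF subspace_UNIV closed_UNIV this]
    show ?thesis by (metis UNIV_I)
  qed
  then obtain S where S: "\<And>x y. T x \<bullet>\<^sub>R y = x \<bullet>\<^sub>R S y" by metis
  have "bounded_linear S"
  proof (rule bounded_linear_intro[where K = "norm T"])
    show "S (x + y) = S x + S y" for x y
      by (rule rinner_ext) (metis S rinner_add_right)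
    show "S (r *\<^sub>R x) = r *\<^sub>R S x" for r x
      by (rule rinner_ext) (metis S rinner_scaleR_right)
    show "norm (S y) \<le> norm y * norm T" for y
    proof (cases "S y = 0")
      case False
      have "(norm (S y))\<^sup>2 = T (S y) \<bullet>\<^sub>R y" by (simp add: S rinner_self)
      also have "\<dots> \<le> norm (T (S y)) * norm y" using abs_rinner_le abs_le_D1 by blast
      also have "\<dots> \<le> norm T * norm (S y) * norm y"
        by (intro mult_right_mono norm_blinfun) simp
      finally show ?thesis using False by (simp add: power2_eq_square mult.commute mult.left_commute)
    qed simp
  qed
  then have "is_adjoint T (Blinfun S)" by (simp add: is_adjoint_def S bounded_linear_Blinfun_apply)
  with that show ?thesis .
qed

definition sym_op :: "('a::chilbert_space \<Rightarrow>\<^sub>L 'a) \<Rightarrow> bool"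
  where "sym_op A \<longleftrightarrow> is_adjoint A A"

definition skew_op :: "('a::chilbert_space \<Rightarrow>\<^sub>L 'a) \<Rightarrow> bool"
  where "skew_op B \<longleftrightarrow> is_adjoint B (- B)"

definition pos_op :: "('a::chilbert_space \<Rightarrow>\<^sub>L 'a) \<Rightarrow> bool"
  where "pos_op A \<longleftrightarrow> sym_op A \<and> (\<forall>x. 0 \<le> A x \<bullet>\<^sub>R x)"

lemma sym_opD:
  fixes A :: "'a::chilbert_space \<Rightarrow>\<^sub>L 'a"
  shows "sym_op A \<Longrightarrow> A x \<bullet>\<^sub>R y = x \<bullet>\<^sub>R A y"
  by (simp add: sym_op_def is_adjoint_def)

lemma sym_opI:
  fixes A :: "'a::chilbert_space \<Rightarrow>\<^sub>L 'a"
  shows "(\<And>x y. A x \<bullet>\<^sub>R y = x \<bullet>\<^sub>R A y) \<Longrightarrow> sym_op A"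
  by (simp add: sym_op_def is_adjoint_def)

lemma skew_opD:
  fixes B :: "'a::chilbert_space \<Rightarrow>\<^sub>L 'a"
  shows "skew_op B \<Longrightarrow> B x \<bullet>\<^sub>R y = - (x \<bullet>\<^sub>R B y)"
  by (simp add: skew_op_def is_adjoint_def blinfun.minus_left rinner_simps)

lemma skew_opI:
  fixes B :: "'a::chilbert_space \<Rightarrow>\<^sub>L 'a"
  shows "(\<And>x y. B x \<bullet>\<^sub>R y = - (x \<bullet>\<^sub>R B y)) \<Longrightarrow> skew_op B"
  by (simp add: skew_op_def is_adjoint_def blinfun.minus_left rinner_simps)

lemma skew_op_self:
  fixes B :: "'a::chilbert_space \<Rightarrow>\<^sub>L 'a"
  shows "skew_op B \<Longrightarrow> x \<bullet>\<^sub>R B x = 0"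
  using skew_opD[of B x x] by (simp add: rinner_commute)

lemma pos_op_sym: "pos_op A \<Longrightarrow> sym_op A"
  by (simp add: pos_op_def)

lemma pos_opD: "pos_op A \<Longrightarrow> 0 \<le> blinfun_apply A x \<bullet>\<^sub>R x"
  by (simp add: pos_op_def)

text \<open>The projection of \<open>y\<close> is the Riesz representer in \<open>S\<close> of the
  inner product with \<open>y\<close>.\<close>

lemma projection_exists:
  fixes S :: "'a::chilbert_space set"
  assumes S: "subspace S" "closed S"
  obtains F where "sym_op F" "\<And>x. F x \<in> S" "\<And>x. x \<in> S \<Longrightarrow> F x = x"
proof -
  have "\<exists>z. z \<in> S \<and> (\<forall>x\<in>S. x \<bullet>\<^sub>R y = x \<bullet>\<^sub>R z)" for y
    using riesz_representation_on[OF S rinner.bounded_linear_left] by metis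
  then obtain p where pS: "\<And>y. p y \<in> S" and p: "\<And>x y. x \<in> S \<Longrightarrow> x \<bullet>\<^sub>R y = x \<bullet>\<^sub>R p y" by metis
  have eqI: "u = v" if "u \<in> S" "v \<in> S" "\<And>x. x \<in> S \<Longrightarrow> x \<bullet>\<^sub>R u = x \<bullet>\<^sub>R v" for u v
  proof -
    have "u - v \<in> S" using S that by (simp add: subspace_diff)
    from that(3)[OF this] show ?thesis
      by (metis eq_iff_diff_eq_0 norm_eq_zero power_eq_0_iff rinner.diff_right rinner_self)
  qed
  have "bounded_linear p"
  proof (rule bounded_linear_intro[where K = 1])
    show "p (x + y) = p x + p y" for x y
      by (rule eqI) (use S in \<open>auto simp: pS subspace_add rinner_add_right simp flip: p\<close>)
    show "p (r *\<^sub>R x) = r *\<^sub>R p x" for r x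
      by (rule eqI) (use S in \<open>auto simp: pS subspace_scale rinner_scaleR_right simp flip: p\<close>)
    show "norm (p y) \<le> norm y * 1" for y
    proof (cases "p y = 0")
      case False
      have "(norm (p y))\<^sup>2 = p y \<bullet>\<^sub>R y" using p[OF pS] by (simp flip: rinner_self)
      also have "\<dots> \<le> norm (p y) * norm y" using abs_rinner_le abs_le_D1 by blast
      finally show ?thesis using False by (simp add: power2_eq_square)
    qed simp
  qed
  then have F: "blinfun_apply (Blinfun p) = p" by (rule bounded_linear_Blinfun_apply)
  show ?thesis
  proof (rule that[of "Blinfun p"])
    show "sym_op (Blinfun p)"
      by (rule sym_opI) (metis F p pS rinner_commute)
    show "Blinfun p x \<in> S" for x by (simp add: F pS)
    show "Blinfun p x = x" if "x \<in> S" for x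
      unfolding F by (rule eqI) (use that in \<open>auto simp: pS simp flip: p\<close>)
  qed
qed

section \<open>Inequalities for positive and self-adjoint operators\<close>

lemma pos_op_cauchy_schwarz:
  assumes "pos_op A"
  shows "(A x \<bullet>\<^sub>R y)\<^sup>2 \<le> (A x \<bullet>\<^sub>R x) * (A y \<bullet>\<^sub>R y)"
proof -
  have sy: "A y \<bullet>\<^sub>R x = A x \<bullet>\<^sub>R y"
    using sym_opD[OF pos_op_sym[OF assms]] by (metis rinner_commute)
  have q: "0 \<le> s\<^sup>2 * (A x \<bullet>\<^sub>R x) + 2 * s * t * (A x \<bullet>\<^sub>R y) + t\<^sup>2 * (A y \<bullet>\<^sub>R y)" for s t :: real
  proof -
    have "0 \<le> A (s *\<^sub>R x + t *\<^sub>R y) \<bullet>\<^sub>R (s *\<^sub>R x + t *\<^sub>R y)" using assms pos_opD by blast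
    then show ?thesis
      by (simp add: blinfun.bilinear_simps rinner_simps sy power2_eq_square algebra_simps)
  qed
  show ?thesis
  proof (cases "A y \<bullet>\<^sub>R y = 0")
    case True
    have "A x \<bullet>\<^sub>R y = 0"
    proof (rule nonneg_quadratic_imp_zero)
      show "0 \<le> 2 * t * (A x \<bullet>\<^sub>R y) + t\<^sup>2 * (A x \<bullet>\<^sub>R x)" for t
        using q[of t 1] True by simp
    qed
    then show ?thesis using True by simp
  next
    case False
    then have a: "A y \<bullet>\<^sub>R y > 0" using pos_opD[OF assms, of y] by simp
    have "0 \<le> (A y \<bullet>\<^sub>R y) * ((A x \<bullet>\<^sub>R x) * (A y \<bullet>\<^sub>R y) - (A x \<bullet>\<^sub>R y)\<^sup>2)"
      using q[of "A y \<bullet>\<^sub>R y" "- (A x \<bullet>\<^sub>R y)"] by (simp add: power2_eq_square algebra_simps)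
    then show ?thesis using a by (simp add: zero_le_mult_iff)
  qed
qed

lemma pos_op_eq_zero:
  assumes "pos_op A" "A x \<bullet>\<^sub>R x = 0"
  shows "A x = 0"
  using pos_op_cauchy_schwarz[OF assms(1), of x "A x"] assms(2) by (simp add: rinner_self)

text \<open>Cauchy-Schwarz for the form of \<open>A\<close>, at \<open>x\<close> and
  \<open>A x\<close>. The bound is asked on the range of \<open>A\<close> because a positive part
  such as \<open>g\<close> below is controlled there first.\<close>

lemma pos_op_sq_le:
  assumes A: "pos_op A" and bd: "\<And>x. A (A x) \<bullet>\<^sub>R A x \<le> s * (norm (A x))\<^sup>2"
  shows "(norm (A x))\<^sup>2 \<le> s * (A x \<bullet>\<^sub>R x)"
proof (cases "A x = 0")
  case False
  have "(norm (A x))\<^sup>2 * (norm (A x))\<^sup>2 = (A x \<bullet>\<^sub>R A x)\<^sup>2" by (simp add: rinner_self power2_eq_square)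
  also have "\<dots> \<le> (A x \<bullet>\<^sub>R x) * (A (A x) \<bullet>\<^sub>R A x)" by (rule pos_op_cauchy_schwarz[OF A])
  also have "\<dots> \<le> (A x \<bullet>\<^sub>R x) * (s * (norm (A x))\<^sup>2)"
    by (intro mult_left_mono bd pos_opD[OF A])
  finally have "(norm (A x))\<^sup>2 * (norm (A x))\<^sup>2 \<le> s * (A x \<bullet>\<^sub>R x) * (norm (A x))\<^sup>2"
    by (simp add: mult_ac)
  moreover have "0 < (norm (A x))\<^sup>2" using False by simp
  ultimately show ?thesis by (rule mult_right_le_imp_le)
qed simp

text \<open>Polarise with \<open>x\<close> and a multiple of \<open>A x\<close> of the same length;
  the parallelogram law turns the bound on the form into one on the norm.\<close>

lemma sym_op_norm_le:
  assumes A: "sym_op A" and bd: "\<And>x. \<bar>A x \<bullet>\<^sub>R x\<bar> \<le> s * (norm x)\<^sup>2"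
  shows "norm (A x) \<le> s * norm x"
proof (cases "A x = 0 \<or> x = 0")
  case True
  have "0 \<le> s * (norm x)\<^sup>2" using bd[of x] by linarith
  then have "0 \<le> s * norm x" by (auto simp: zero_le_mult_iff)
  with True show ?thesis by auto
next
  case False
  define k where "k = norm x / norm (A x)"
  define y where "y = k *\<^sub>R A x"
  have k: "k > 0" and ny: "norm y = norm x" using False by (auto simp: k_def y_def)
  have "4 * (A x \<bullet>\<^sub>R y) = A (x + y) \<bullet>\<^sub>R (x + y) - A (x - y) \<bullet>\<^sub>R (x - y)"
    using sym_opD[OF A, of y x]
    by (simp add: blinfun.bilinear_simps rinner_simps rinner_commute)
  also have "\<dots> \<le> s * (norm (x + y))\<^sup>2 + s * (norm (x - y))\<^sup>2"
    using bd[of "x + y"] bd[of "x - y"] by linarith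
  also have "\<dots> = 4 * (s * (norm x)\<^sup>2)" by (simp add: norm_add_sq norm_diff_sq ny algebra_simps)
  finally have "k * (norm (A x))\<^sup>2 \<le> s * (norm x)\<^sup>2"
    by (simp add: y_def rinner_simps rinner_self)
  moreover have "k * (norm (A x))\<^sup>2 = norm x * norm (A x)"
    using False by (simp add: k_def power2_eq_square)
  ultimately have "norm x * norm (A x) \<le> s * (norm x)\<^sup>2" by linarith
  then have "norm (A x) * norm x \<le> (s * norm x) * norm x"
    by (simp add: power2_eq_square mult_ac)
  then show ?thesis using False by simp
qed

section \<open>Positive square roots\<close>

definition commute_op :: "('a::chilbert_space \<Rightarrow>\<^sub>L 'a) \<Rightarrow> ('a \<Rightarrow>\<^sub>L 'a) \<Rightarrow> bool"
  where "commute_op A B \<longleftrightarrow> (\<forall>x. A (B x) = B (A x))"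

lemma commute_opD:
  fixes A B :: "'a::chilbert_space \<Rightarrow>\<^sub>L 'a"
  shows "commute_op A B \<Longrightarrow> A (B x) = B (A x)"
  by (simp add: commute_op_def)

text \<open>The factor \<open>s\<close> covers limits of self-adjoint operators
  (\<open>s = 1\<close>) and of skew ones (\<open>s = -1\<close>) at once.\<close>

lemma is_adjoint_limit:
  fixes Y :: "nat \<Rightarrow> 'a::chilbert_space \<Rightarrow>\<^sub>L 'a"
  assumes "Y \<longlonglongrightarrow> Z" "\<And>n. is_adjoint (Y n) (s *\<^sub>R Y n)"
  shows "is_adjoint Z (s *\<^sub>R Z)"
  unfolding is_adjoint_def
proof (intro allI)
  fix x y
  have "(\<lambda>n. Y n x \<bullet>\<^sub>R y) \<longlonglongrightarrow> Z x \<bullet>\<^sub>R y" "(\<lambda>n. x \<bullet>\<^sub>R (s *\<^sub>R Y n) y) \<longlonglongrightarrow> x \<bullet>\<^sub>R (s *\<^sub>R Z) y"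
    by (intro rinner.tendsto blinfun.tendsto tendsto_intros assms(1))+
  then show "Z x \<bullet>\<^sub>R y = x \<bullet>\<^sub>R (s *\<^sub>R Z) y"
    using assms(2) by (simp add: is_adjoint_def LIMSEQ_unique)
qed

text \<open>
  With \<open>R = 1 - A\<close> the iteration \<open>Y \<mapsto> (R + Y\<^sup>2)/2\<close> converges to \<open>1 - \<surd>A\<close>; its scalar instance \<open>R = 1\<close>
  majorizes the increments in norm.
\<close>

primrec sqrt_scalar :: "nat \<Rightarrow> real" where
  "sqrt_scalar 0 = 0"
| "sqrt_scalar (Suc n) = (1 + (sqrt_scalar n)\<^sup>2) / 2"

primrec sqrt_iter :: "('a::chilbert_space \<Rightarrow>\<^sub>L 'a) \<Rightarrow> nat \<Rightarrow> 'a \<Rightarrow>\<^sub>L 'a" where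
  "sqrt_iter R 0 = 0"
| "sqrt_iter R (Suc n) = (1/2) *\<^sub>R (R + (sqrt_iter R n o\<^sub>L sqrt_iter R n))"

lemma sqrt_scalar_bounds: "0 \<le> sqrt_scalar n \<and> sqrt_scalar n \<le> 1"
  by (induction n) (auto intro: power_le_one)

lemma incseq_sqrt_scalar: "incseq sqrt_scalar"
proof (rule incseq_SucI)
  fix n
  have "0 \<le> (1 - sqrt_scalar n)\<^sup>2" by simp
  then show "sqrt_scalar n \<le> sqrt_scalar (Suc n)" by (simp add: power2_diff)
qed

lemma norm_sqrt_iter:
  assumes "norm R \<le> 1"
  shows "norm (sqrt_iter R n) \<le> sqrt_scalar n"
proof (induction n)
  case (Suc n)
  have "norm (sqrt_iter R n o\<^sub>L sqrt_iter R n) \<le> norm (sqrt_iter R n) * norm (sqrt_iter R n)"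
    by (rule norm_blinfun_compose)
  also have "\<dots> \<le> (sqrt_scalar n)\<^sup>2"
    unfolding power2_eq_square using Suc by (intro mult_mono) (auto simp: sqrt_scalar_bounds)
  finally show ?case
    using assms norm_triangle_ineq[of R "sqrt_iter R n o\<^sub>L sqrt_iter R n"] by simp
qed simp

lemma norm_sqrt_iter_Suc_diff:
  assumes R: "norm R \<le> 1"
  shows "norm (sqrt_iter R (Suc n) - sqrt_iter R n) \<le> sqrt_scalar (Suc n) - sqrt_scalar n"
proof (induction n)
  case 0
  show ?case using R by simp
next
  case (Suc n)
  define Y where "Y = sqrt_iter R n"
  define Y' where "Y' = sqrt_iter R (Suc n)"
  define y where "y = sqrt_scalar n"
  define y' where "y' = sqrt_scalar (Suc n)"
  have IH: "norm (Y' - Y) \<le> y' - y" using Suc unfolding Y'_def Y_def y'_def y_def .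
  have bd: "norm Y \<le> y" "norm Y' \<le> y'" using norm_sqrt_iter[OF R] by (auto simp only: Y_def Y'_def y_def y'_def)
  \<comment> \<open>This splitting of the difference of two squares needs no commutation.\<close>
  have "sqrt_iter R (Suc (Suc n)) - Y' = (1/2) *\<^sub>R ((Y' o\<^sub>L (Y' - Y)) + ((Y' - Y) o\<^sub>L Y))"
  proof -
    have "sqrt_iter R (Suc (Suc n)) = (1/2) *\<^sub>R (R + (Y' o\<^sub>L Y'))" by (simp add: Y'_def)
    moreover have "Y' = (1/2) *\<^sub>R (R + (Y o\<^sub>L Y))" by (simp add: Y'_def Y_def)
    ultimately show ?thesis
      by (intro blinfun_eqI) (simp add: blinfun.bilinear_simps algebra_simps)
  qed
  also have "norm \<dots> \<le> (1/2) * (norm Y' * norm (Y' - Y) + norm (Y' - Y) * norm Y)"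
    by (auto intro!: order_trans[OF norm_triangle_ineq] add_mono norm_blinfun_compose)
  also have "\<dots> \<le> (1/2) * (y' * (y' - y) + (y' - y) * y)"
    using bd IH order_trans[OF norm_ge_zero bd(2)] order_trans[OF norm_ge_zero IH]
    by (intro mult_left_mono add_mono mult_mono) auto
  also have "\<dots> = sqrt_scalar (Suc (Suc n)) - y'"
    by (simp add: y'_def y_def power2_eq_square algebra_simps)
  finally show ?case unfolding Y'_def y'_def .
qed

lemma norm_sqrt_iter_diff:
  assumes R: "norm R \<le> 1" and "n \<le> m"
  shows "norm (sqrt_iter R m - sqrt_iter R n) \<le> sqrt_scalar m - sqrt_scalar n"
  using \<open>n \<le> m\<close>
proof (induction m rule: dec_induct)
  case (step m)
  have "norm (sqrt_iter R (Suc m) - sqrt_iter R n)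
      \<le> norm (sqrt_iter R (Suc m) - sqrt_iter R m) + norm (sqrt_iter R m - sqrt_iter R n)"
    by (metis norm_triangle_ineq diff_add_cancel add_diff_eq)
  with step.IH norm_sqrt_iter_Suc_diff[OF R, of m] show ?case by linarith
qed simp

lemma convergent_sqrt_iter:
  assumes R: "norm R \<le> 1"
  shows "convergent (sqrt_iter R)"
proof -
  have "convergent sqrt_scalar"
    using incseq_sqrt_scalar sqrt_scalar_bounds
    by (intro Bseq_mono_convergent BseqI'[of _ 1]) (auto dest: incseqD)
  then have "Cauchy sqrt_scalar" by (rule convergent_Cauchy)
  have "Cauchy (sqrt_iter R)"
  proof (rule CauchyI')
    fix e :: real assume "0 < e"
    then obtain M where M: "\<And>m n. m \<ge> M \<Longrightarrow> n \<ge> M \<Longrightarrow> norm (sqrt_scalar m - sqrt_scalar n) < e"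
      using CauchyD[OF \<open>Cauchy sqrt_scalar\<close>] by blast
    have "norm (sqrt_iter R m - sqrt_iter R n) < e" if "m \<ge> M" "n > m" for m n
      using norm_sqrt_iter_diff[OF R, of m n] M[of n m] that
      by (simp add: norm_minus_commute)
    then show "\<exists>M. \<forall>m\<ge>M. \<forall>n>m. dist (sqrt_iter R m) (sqrt_iter R n) < e"
      unfolding dist_norm by blast
  qed
  then show ?thesis by (rule Cauchy_convergent)
qed

text \<open>The root is a norm limit of polynomials in \<open>A\<close>, whence the clause on
  commuting operators. That clause does the work of a functional calculus below.\<close>

lemma pos_op_sqrt_exists:
  fixes A :: "'a::chilbert_space \<Rightarrow>\<^sub>L 'a"
  assumes A: "pos_op A"
  obtains B where "pos_op B" "\<And>x. B (B x) = A x"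
    "\<And>X. commute_op X A \<Longrightarrow> commute_op X B"
proof -
  \<comment> \<open>Division by \<open>s\<close> brings the spectrum into [0, 1], so that
    \<open>R\<close> has norm at most 1; the summand 1 keeps \<open>s\<close> positive when
    \<open>A = 0\<close>.\<close>
  define s where "s = norm A + 1"
  have s: "s > 0" by (auto simp: s_def add_nonneg_pos)
  define R where "R = id_blinfun - (1/s) *\<^sub>R A"
  have Rx: "R x = x - (1/s) *\<^sub>R A x" for x by (simp add: R_def blinfun.bilinear_simps)
  have R_sym: "sym_op R"
    using pos_op_sym[OF A] by (auto intro!: sym_opI simp: Rx rinner_simps sym_opD)
  have "norm (R x) \<le> 1 * norm x" for x
  proof (rule sym_op_norm_le[OF R_sym])
    fix x
    have "A x \<bullet>\<^sub>R x \<le> norm (A x) * norm x" using abs_rinner_le abs_le_D1 by blast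
    also have "\<dots> \<le> (s * norm x) * norm x"
      using norm_blinfun[of A x] by (intro mult_right_mono) (auto simp: s_def algebra_simps intro: add_increasing)
    finally have "(1/s) * (A x \<bullet>\<^sub>R x) \<le> (norm x)\<^sup>2" using s by (simp add: field_simps power2_eq_square)
    moreover have "0 \<le> (1/s) * (A x \<bullet>\<^sub>R x)" using s pos_opD[OF A] by simp
    ultimately show "\<bar>R x \<bullet>\<^sub>R x\<bar> \<le> 1 * (norm x)\<^sup>2"
      by (simp add: Rx rinner_simps rinner_self abs_le_iff)
  qed
  then have R: "norm R \<le> 1" by (intro norm_blinfun_bound) auto
  obtain Y where Y: "sqrt_iter R \<longlonglongrightarrow> Y"
    using convergent_sqrt_iter[OF R] by (auto simp: convergent_def)
  have Y_eq: "Y = (1/2) *\<^sub>R (R + (Y o\<^sub>L Y))"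
  proof (rule LIMSEQ_unique)
    show "(\<lambda>n. sqrt_iter R (Suc n)) \<longlonglongrightarrow> Y" using Y by (rule LIMSEQ_Suc)
    show "(\<lambda>n. sqrt_iter R (Suc n)) \<longlonglongrightarrow> (1/2) *\<^sub>R (R + (Y o\<^sub>L Y))"
      by (auto intro!: tendsto_intros Y bounded_bilinear.tendsto[OF bounded_bilinear_blinfun_compose])
  qed
  have Y_norm: "norm Y \<le> 1"
    using norm_sqrt_iter[OF R] sqrt_scalar_bounds
    by (intro LIMSEQ_le_const2[OF tendsto_norm[OF Y]]) (meson order_trans)
  have "sym_op (sqrt_iter R n)" for n
  proof (induction n)
    case (Suc n)
    then show ?case using R_sym
      by (auto intro!: sym_opI simp: blinfun.bilinear_simps rinner_simps sym_opD)
  qed (auto intro!: sym_opI)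
  then have Y_sym: "sym_op Y"
    using is_adjoint_limit[OF Y, of 1] by (simp add: sym_op_def)
  \<comment> \<open>The limit satisfies (1 - Y)^2 = A/s; the factor \<open>sqrt s\<close> undoes the
    scaling.\<close>
  define B where "B = sqrt s *\<^sub>R (id_blinfun - Y)"
  have Bx: "B x = sqrt s *\<^sub>R (x - Y x)" for x by (simp add: B_def blinfun.bilinear_simps)
  show ?thesis
  proof
    have "Y x \<bullet>\<^sub>R x \<le> (norm x)\<^sup>2" for x
    proof -
      have "Y x \<bullet>\<^sub>R x \<le> norm (Y x) * norm x" using abs_rinner_le abs_le_D1 by blast
      also have "\<dots> \<le> (1 * norm x) * norm x"
        using norm_blinfun[of Y x] Y_norm
        by (intro mult_right_mono order_trans[OF norm_blinfun]) auto
      finally show ?thesis by (simp add: power2_eq_square)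
    qed
    then show "pos_op B"
      using Y_sym s
      by (auto simp: pos_op_def Bx rinner_simps sym_opD rinner_self intro!: sym_opI)
    show "B (B x) = A x" for x
    proof -
      have "Y x = (1/2) *\<^sub>R (R x + Y (Y x))"
        by (subst Y_eq) (simp add: blinfun.bilinear_simps)
      then have "2 *\<^sub>R Y x = 2 *\<^sub>R (1/2) *\<^sub>R (R x + Y (Y x))" by (rule arg_cong)
      then have "2 *\<^sub>R Y x = R x + Y (Y x)" by simp
      then have "Y (Y x) = 2 *\<^sub>R Y x - x + (1/s) *\<^sub>R A x" by (simp add: Rx algebra_simps)
      then have YY: "x - 2 *\<^sub>R Y x + Y (Y x) = (1/s) *\<^sub>R A x" by (simp add: algebra_simps)
      have "B (B x) = s *\<^sub>R (x - 2 *\<^sub>R Y x + Y (Y x))"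
        using s by (simp add: Bx blinfun.bilinear_simps scaleR_2 algebra_simps)
      then show ?thesis using s by (simp add: YY)
    qed
    fix X assume X: "commute_op X A"
    have it: "commute_op X (sqrt_iter R n)" for n
    proof (induction n)
      case (Suc n)
      then show ?case using X by (simp add: commute_op_def blinfun.bilinear_simps Rx)
    qed (simp add: commute_op_def)
    have "X (Y x) = Y (X x)" for x
    proof (rule LIMSEQ_unique)
      show "(\<lambda>n. X (sqrt_iter R n x)) \<longlonglongrightarrow> X (Y x)"
        by (intro blinfun.tendsto tendsto_const Y)
      show "(\<lambda>n. X (sqrt_iter R n x)) \<longlonglongrightarrow> Y (X x)"
        using it by (auto simp: commute_op_def intro!: blinfun.tendsto tendsto_const Y)
    qed
    then show "commute_op X B" by (simp add: commute_op_def Bx blinfun.bilinear_simps)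
  qed
qed

text \<open>By commutation, B + B' kills z = (B - B')x; positivity then gives Bz = B'z = 0, and so z
  = 0. In each use one root is the constructed one, which supplies the commutation.\<close>

lemma pos_op_sqrt_unique:
  fixes B B' :: "'a::chilbert_space \<Rightarrow>\<^sub>L 'a"
  assumes B: "pos_op B" and B': "pos_op B'" and sq: "\<And>x. B (B x) = B' (B' x)" and comm: "commute_op B B'"
  shows "B = B'"
proof (rule blinfun_eqI)
  fix x
  define z where "z = B x - B' x"
  have sum0: "B z + B' z = 0"
    using commute_opD[OF comm, of x] by (simp add: z_def blinfun.bilinear_simps sq)
  have "B z \<bullet>\<^sub>R z + B' z \<bullet>\<^sub>R z = 0" using sum0 by (simp flip: rinner_add_left)
  then have "B z \<bullet>\<^sub>R z = 0" "B' z \<bullet>\<^sub>R z = 0" using pos_opD[OF B, of z] pos_opD[OF B', of z] by linarith+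
  then have "B z = 0" "B' z = 0" using pos_op_eq_zero B B' by blast+
  moreover have "(norm z)\<^sup>2 = x \<bullet>\<^sub>R B z - x \<bullet>\<^sub>R B' z"
    by (simp add: z_def rinner_simps blinfun.bilinear_simps flip: rinner_self sym_opD[OF pos_op_sym[OF B]] sym_opD[OF pos_op_sym[OF B']])
  ultimately show "B x = B' x" by (simp add: z_def)
qed

lemma pos_op_square:
  fixes g :: "'a::chilbert_space \<Rightarrow>\<^sub>L 'a"
  assumes g: "sym_op g"
  shows "pos_op (g o\<^sub>L g)"
  unfolding pos_op_def
proof (intro conjI allI)
  show "sym_op (g o\<^sub>L g)" by (rule sym_opI) (simp add: sym_opD[OF g])
  show "0 \<le> (g o\<^sub>L g) x \<bullet>\<^sub>R x" for x
    using sym_opD[OF g, of "g x" x] by (simp add: rinner_self)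
qed

text \<open>The argument identifies \<open>g\<close> with its modulus \<open>p\<close>. It serves
  for a positive part, whose form is visibly nonnegative only on its own range.\<close>

lemma pos_op_if_pos_on_range:
  fixes g :: "'a::chilbert_space \<Rightarrow>\<^sub>L 'a"
  assumes g: "sym_op g" and pos: "\<And>x. 0 \<le> g (g x) \<bullet>\<^sub>R g x"
  shows "pos_op g"
proof -
  have "pos_op (g o\<^sub>L g)" by (rule pos_op_square[OF g])
  then obtain p where p: "pos_op p" and pp: "\<And>x. p (p x) = (g o\<^sub>L g) x"
    and comm: "\<And>X. commute_op X (g o\<^sub>L g) \<Longrightarrow> commute_op X p"
    by (rule pos_op_sqrt_exists) blast
  have gp: "g (p x) = p (g x)" for x
    using comm[of g] by (simp add: commute_op_def)
  note ps = sym_opD[OF pos_op_sym[OF p]] and gs = sym_opD[OF g]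
  have "p y = g y" for y
  proof -
    \<comment> \<open>\<open>z\<close> is twice the negative part of \<open>g\<close>, applied to
      \<open>y\<close>; there \<open>g\<close> acts as \<open>- p\<close>.\<close>
    define z where "z = p y - g y"
    have gz: "g z = - p z" by (simp add: z_def blinfun.bilinear_simps pp gp)
    have "p (p z) \<bullet>\<^sub>R p z = - (g (g z) \<bullet>\<^sub>R g z)"
      by (simp add: gz blinfun.bilinear_simps rinner_simps gp)
    then have "p (p z) \<bullet>\<^sub>R p z = 0" using pos[of z] pos_opD[OF p, of "p z"] by linarith
    then have "p (p z) = 0" using pos_op_eq_zero[OF p] by blast
    then have "p z = 0" using ps[of "p z" z] by (simp add: rinner_self)
    moreover have "(norm z)\<^sup>2 = y \<bullet>\<^sub>R p z - y \<bullet>\<^sub>R g z"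
      by (simp add: z_def rinner_simps blinfun.bilinear_simps flip: rinner_self ps gs)
    ultimately have "z = 0" by (simp add: gz)
    then show ?thesis by (simp add: z_def)
  qed
  then have "p = g" by (rule blinfun_eqI)
  with p show ?thesis by simp
qed

section \<open>Operator equations and a descent principle\<close>

text \<open>
  If \<open>\<parallel>Kx\<parallel>\<close> is close to \<open>\<mu> = \<parallel>K\<parallel>\<close>, then \<open>K\<^sup>2x\<close> is close to \<open>-\<mu>\<^sup>2x\<close>, so the hypothesis at \<open>Kx\<close> bounds
  \<open>\<langle>ax, Kx\<rangle>\<close> from above by a small number, while at \<open>x\<close> it bounds it from below.
\<close>

lemma skew_op_riccati_zero:
  fixes a K :: "'a::chilbert_space \<Rightarrow>\<^sub>L 'a"
  assumes a: "sym_op a" and K: "skew_op K"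
    and ineq: "\<And>x. (norm (K x))\<^sup>2 \<le> 2 * (a x \<bullet>\<^sub>R K x)"
  shows "K = 0"
proof (rule ccontr)
  assume "K \<noteq> 0"
  define \<mu> where "\<mu> = norm K"
  define k where "k = norm a"
  \<comment> \<open>\<open>q\<close> is the ratio produced by the estimate \<open>le\<close>; being
    below 1, it contradicts \<open>\<mu>\<close> being the norm of \<open>K\<close>.\<close>
  define q where "q = 8 * k\<^sup>2 / (\<mu>\<^sup>2 + 8 * k\<^sup>2)"
  have \<mu>: "\<mu> > 0" using \<open>K \<noteq> 0\<close> by (simp add: \<mu>_def)
  have q: "0 \<le> q" "q < 1" using \<mu> by (auto simp: q_def divide_less_eq add_pos_nonneg)
  have le: "(norm (K x))\<^sup>2 \<le> q * \<mu>\<^sup>2 * (norm x)\<^sup>2" for x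
  proof -
    \<comment> \<open>\<open>w\<close> is the error in K^2 x = - \<mu>^2 x, controlled by the defect
      \<mu>^2 |x|^2 - |Kx|^2.\<close>
    define w where "w = K (K x) + \<mu>\<^sup>2 *\<^sub>R x"
    have K2: "x \<bullet>\<^sub>R K (K x) = - (norm (K x))\<^sup>2"
      using skew_opD[OF K, of x "K x"] by (simp add: rinner_self)
    have "norm (K (K x)) \<le> \<mu> * norm (K x)" unfolding \<mu>_def by (rule norm_blinfun)
    then have "(norm (K (K x)))\<^sup>2 \<le> \<mu>\<^sup>2 * (norm (K x))\<^sup>2"
      by (metis norm_ge_zero power_mono power_mult_distrib)
    moreover have "(norm w)\<^sup>2 = (norm (K (K x)))\<^sup>2 - 2 * \<mu>\<^sup>2 * (norm (K x))\<^sup>2 + \<mu>\<^sup>2 * (\<mu>\<^sup>2 * (norm x)\<^sup>2)"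
      unfolding w_def norm_add_sq by (simp add: rinner_simps rinner_commute[of "K (K x)" x] K2 power2_eq_square)
    ultimately have w: "(norm w)\<^sup>2 \<le> \<mu>\<^sup>2 * (\<mu>\<^sup>2 * (norm x)\<^sup>2 - (norm (K x))\<^sup>2)"
      by (simp add: algebra_simps)
    have "a (K x) \<bullet>\<^sub>R K (K x) = a (K x) \<bullet>\<^sub>R w - \<mu>\<^sup>2 * (a x \<bullet>\<^sub>R K x)"
      by (simp add: w_def rinner_simps sym_opD[OF a] rinner_commute[of "K x" "a x"])
    moreover have "0 \<le> 2 * (a (K x) \<bullet>\<^sub>R K (K x))" by (rule order_trans[OF zero_le_power2 ineq])
    ultimately have "0 \<le> 2 * (a (K x) \<bullet>\<^sub>R w) - \<mu>\<^sup>2 * (2 * (a x \<bullet>\<^sub>R K x))" by simp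
    moreover have "\<mu>\<^sup>2 * (norm (K x))\<^sup>2 \<le> \<mu>\<^sup>2 * (2 * (a x \<bullet>\<^sub>R K x))"
      by (intro mult_left_mono ineq) simp
    moreover have "a (K x) \<bullet>\<^sub>R w \<le> k * norm (K x) * norm w"
      using abs_rinner_le[of "a (K x)" w] norm_blinfun[of a "K x"] unfolding k_def
      by (smt (verit) mult_right_mono norm_ge_zero)
    ultimately have *: "\<mu>\<^sup>2 * (norm (K x))\<^sup>2 \<le> 2 * k * norm (K x) * norm w" by linarith
    have "\<mu>\<^sup>2 * norm (K x) \<le> 2 * k * norm w"
    proof (cases "norm (K x) = 0")
      case False
      with * have "(\<mu>\<^sup>2 * norm (K x)) * norm (K x) \<le> (2 * k * norm w) * norm (K x)"
        by (simp add: power2_eq_square mult_ac)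
      with False show ?thesis by simp
    qed (simp add: k_def)
    then have "(\<mu>\<^sup>2 * norm (K x))\<^sup>2 \<le> (2 * k * norm w)\<^sup>2" by (intro power_mono) auto
    also have "\<dots> = 4 * k\<^sup>2 * (norm w)\<^sup>2" by (simp add: power_mult_distrib)
    also have "\<dots> \<le> 4 * k\<^sup>2 * (\<mu>\<^sup>2 * (\<mu>\<^sup>2 * (norm x)\<^sup>2 - (norm (K x))\<^sup>2))"
      by (intro mult_left_mono w) simp
    finally have "\<mu>\<^sup>2 * (\<mu>\<^sup>2 * (norm (K x))\<^sup>2) \<le> \<mu>\<^sup>2 * (4 * k\<^sup>2 * (\<mu>\<^sup>2 * (norm x)\<^sup>2 - (norm (K x))\<^sup>2))"
      by (simp add: power_mult_distrib power2_eq_square mult_ac)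
    then have "\<mu>\<^sup>2 * (norm (K x))\<^sup>2 \<le> 4 * k\<^sup>2 * (\<mu>\<^sup>2 * (norm x)\<^sup>2 - (norm (K x))\<^sup>2)"
      by (rule mult_left_le_imp_le) (use \<mu> in simp)
    moreover have "0 \<le> \<mu>\<^sup>2 * (norm x)\<^sup>2 - (norm (K x))\<^sup>2"
      by (metis \<mu>_def diff_ge_0_iff_ge norm_blinfun norm_ge_zero power_mono power_mult_distrib)
    then have "4 * k\<^sup>2 * (\<mu>\<^sup>2 * (norm x)\<^sup>2 - (norm (K x))\<^sup>2)
        \<le> 8 * k\<^sup>2 * (\<mu>\<^sup>2 * (norm x)\<^sup>2 - (norm (K x))\<^sup>2)"
      by (intro mult_right_mono) auto
    ultimately have "\<mu>\<^sup>2 * (norm (K x))\<^sup>2 \<le> 8 * k\<^sup>2 * (\<mu>\<^sup>2 * (norm x)\<^sup>2 - (norm (K x))\<^sup>2)"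
      by (rule order_trans)
    then have "(\<mu>\<^sup>2 + 8 * k\<^sup>2) * (norm (K x))\<^sup>2 \<le> 8 * k\<^sup>2 * (\<mu>\<^sup>2 * (norm x)\<^sup>2)"
      by (simp add: algebra_simps)
    then show ?thesis using \<mu> by (simp add: q_def field_simps add_pos_nonneg)
  qed
  have "norm K \<le> sqrt q * \<mu>"
  proof (rule norm_blinfun_bound)
    show "0 \<le> sqrt q * \<mu>" using q \<mu> by simp
    show "norm (K x) \<le> sqrt q * \<mu> * norm x" for x
    proof (rule power2_le_imp_le)
      show "(norm (K x))\<^sup>2 \<le> (sqrt q * \<mu> * norm x)\<^sup>2"
        using le[of x] q by (simp add: power_mult_distrib)
      show "0 \<le> sqrt q * \<mu> * norm x" using q \<mu> by simp
    qed
  qed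
  moreover have "sqrt q * \<mu> < 1 * \<mu>" using q \<mu> by (intro mult_strict_right_mono) auto
  ultimately show False by (simp add: \<mu>_def)
qed

text \<open>
  With \<open>c = r - a\<close> the equation for \<open>K\<close> reads \<open>cKc - aKa = B\<close>.
\<close>

lemma lyapunov_skew_solution:
  fixes a B :: "'a::chilbert_space \<Rightarrow>\<^sub>L 'a"
  assumes a: "sym_op a" "norm a \<le> r / 4" and B: "skew_op B" and r: "r > 0"
  obtains K where "skew_op K" "\<And>x. r\<^sup>2 *\<^sub>R K x = B x + r *\<^sub>R (a (K x) + K (a x))"
proof -
  define S :: "('a \<Rightarrow>\<^sub>L 'a) set" where "S = {K. skew_op K}"
  \<comment> \<open>The fixed point equation of \<open>f\<close> is cKc - aKa = B multiplied out and
    divided by r^2. The bound r/4 on \<open>a\<close> makes \<open>f\<close> a contraction with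
    constant 1/2, and the closed set \<open>S\<close> keeps the fixed point skew.\<close>
  define f where "f K = (1/r\<^sup>2) *\<^sub>R B + (1/r) *\<^sub>R ((a o\<^sub>L K) + (K o\<^sub>L a))" for K
  have "\<exists>!K\<in>S. f K = K"
  proof (rule Banach_fix)
    have "closed S"
      unfolding closed_sequential_limits
    proof safe
      fix X Z assume X: "\<forall>n. X n \<in> S" "X \<longlonglongrightarrow> Z"
      have "is_adjoint Z ((-1) *\<^sub>R Z)"
        using X by (intro is_adjoint_limit[of X Z]) (auto simp: S_def skew_op_def)
      then show "Z \<in> S" by (simp add: S_def skew_op_def)
    qed
    then show "complete S" by (simp add: complete_eq_closed)
    have "0 \<in> S" by (auto simp: S_def intro!: skew_opI)
    then show "S \<noteq> {}" by blast
    show "f ` S \<subseteq> S"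
      using a(1) B by (auto simp: S_def f_def blinfun.bilinear_simps rinner_simps skew_opD sym_opD
          diff_divide_distrib add_divide_distrib intro!: skew_opI)
    show "dist (f K) (f L) \<le> (1/2) * dist K L" if "K \<in> S" "L \<in> S" for K L
    proof -
      have "f K - f L = (1/r) *\<^sub>R ((a o\<^sub>L (K - L)) + ((K - L) o\<^sub>L a))"
        by (rule blinfun_eqI) (simp add: f_def blinfun.bilinear_simps algebra_simps)
      then have "norm (f K - f L) = (1/r) * norm ((a o\<^sub>L (K - L)) + ((K - L) o\<^sub>L a))"
        using r by simp
      also have "\<dots> \<le> (1/r) * (norm a * norm (K - L) + norm (K - L) * norm a)"
        using r by (intro mult_left_mono order_trans[OF norm_triangle_ineq] add_mono norm_blinfun_compose) auto
      also have "\<dots> \<le> (1/r) * (r/4 * norm (K - L) + norm (K - L) * (r/4))"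
        using r a(2) by (intro mult_left_mono add_mono mult_right_mono) auto
      also have "\<dots> = (1/2) * norm (K - L)" using r by simp
      finally show ?thesis by (simp add: dist_norm)
    qed
  qed auto
  then obtain K where K: "skew_op K" "f K = K" by (auto simp: S_def)
  show ?thesis
  proof (rule that[OF K(1)])
    fix x
    have "r\<^sup>2 *\<^sub>R K x = r\<^sup>2 *\<^sub>R f K x" by (simp add: K(2))
    also have "\<dots> = B x + r *\<^sub>R (a (K x) + K (a x))"
      using r by (simp add: f_def blinfun.bilinear_simps scaleR_add_right power2_eq_square)
    finally show "r\<^sup>2 *\<^sub>R K x = B x + r *\<^sub>R (a (K x) + K (a x))" .
  qed
qed

text \<open>A preimage of \<open>u\<close> under r - a is the fixed point of y \<mapsto> (u + a
  y)/r, a contraction with constant 1/4.\<close>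

lemma surj_perturbation:
  fixes a :: "'a::chilbert_space \<Rightarrow>\<^sub>L 'a"
  assumes a: "norm a \<le> r / 4" and r: "r > 0"
  obtains y where "r *\<^sub>R y - a y = u"
proof -
  have "\<exists>!y. (1/r) *\<^sub>R (u + a y) = y"
  proof (rule banach_fix_type)
    show "\<forall>x y. dist ((1/r) *\<^sub>R (u + a x)) ((1/r) *\<^sub>R (u + a y)) \<le> (1/4) * dist x y"
    proof (intro allI)
      fix x y
      have "norm (a (x - y)) \<le> r / 4 * norm (x - y)"
        by (intro order_trans[OF norm_blinfun] mult_right_mono a) auto
      moreover have "(1/r) *\<^sub>R (u + a x) - (1/r) *\<^sub>R (u + a y) = (1/r) *\<^sub>R a (x - y)"
        by (simp add: blinfun.bilinear_simps scaleR_add_right scaleR_diff_right)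
      ultimately show "dist ((1/r) *\<^sub>R (u + a x)) ((1/r) *\<^sub>R (u + a y)) \<le> (1/4) * dist x y"
        using r by (simp add: dist_norm field_simps)
    qed
  qed auto
  then obtain y where "(1/r) *\<^sub>R (u + a y) = y" by blast
  then have "r *\<^sub>R y = r *\<^sub>R (1/r) *\<^sub>R (u + a y)" by simp
  with r have "r *\<^sub>R y - a y = u" by simp
  with that show ?thesis .
qed

text \<open>After \<open>n\<close> descents the norm has shrunk by 2^n, so the lower bound has
  improved by 4^n, while \<open>S\<close> has not increased.\<close>

lemma quadratic_nonneg_by_descent:
  fixes S :: "'a::real_normed_vector \<Rightarrow> real"
  assumes bd: "\<And>u. - k * (norm u)\<^sup>2 \<le> S u"
    and desc: "\<And>u. \<exists>v. norm v \<le> norm u / 2 \<and> S v \<le> S u"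
  shows "0 \<le> S u"
proof -
  have k: "- (\<bar>k\<bar> * (norm u)\<^sup>2 * (1/4)^n) \<le> S u" for n u
  proof (induction n arbitrary: u)
    case 0
    have "k * (norm u)\<^sup>2 \<le> \<bar>k\<bar> * (norm u)\<^sup>2" by (intro mult_right_mono) auto
    with bd[of u] show ?case by simp
  next
    case (Suc n)
    obtain v where v: "norm v \<le> norm u / 2" "S v \<le> S u" using desc by blast
    have "(norm v)\<^sup>2 \<le> (norm u)\<^sup>2 / 4"
      using power_mono[OF v(1), of 2] by (simp add: power_divide)
    then have "\<bar>k\<bar> * (norm v)\<^sup>2 * (1/4)^n \<le> \<bar>k\<bar> * ((norm u)\<^sup>2 / 4) * (1/4)^n"
      by (intro mult_right_mono mult_left_mono) auto
    with Suc[of v] v(2) show ?case by simp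
  qed
  have "(\<lambda>n. - (\<bar>k\<bar> * (norm u)\<^sup>2 * (1/4)^n)) \<longlonglongrightarrow> - (\<bar>k\<bar> * (norm u)\<^sup>2 * 0)"
    by (intro tendsto_intros LIMSEQ_power_zero) auto
  then show ?thesis using k by (intro LIMSEQ_le_const2[where X = "\<lambda>n. - (\<bar>k\<bar> * (norm u)\<^sup>2 * (1/4)^n)"]) auto
qed

section \<open>Vanishing of the skew part\<close>

text \<open>
  Here \<open>D = |X|\<close>, so \<open>D + X\<close> is twice the positive part of \<open>A - 3r/4\<close>, whose range spans the
  spectral subspace of \<open>A\<close> for \<open>[3r/4, r]\<close>. In the proof \<open>c\<close> agrees with \<open>A\<close> there.
\<close>

lemma skew_part_vanishes_on_spectral_window:
  fixes A B C M D :: "'a::chilbert_space \<Rightarrow>\<^sub>L 'a"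
  assumes A: "sym_op A" and B: "skew_op B" and C: "pos_op C" and CC: "\<And>x. C (C x) = A (A x)"
    and CA: "commute_op C A" and M: "pos_op M" and CM: "pos_op (C - M)"
    and r: "r > 0" and Ar: "\<And>x. norm (A x) \<le> r * norm x"
    and E: "\<And>x. (norm (B x))\<^sup>2 + 2 * (A x \<bullet>\<^sub>R B x) = (norm (M x))\<^sup>2 - 2 * (C x \<bullet>\<^sub>R M x)"
    and X: "X = A - (3/4 * r) *\<^sub>R id_blinfun"
    and D: "pos_op D" and DD: "\<And>x. D (D x) = X (X x)"
    and DA: "commute_op D A" and DC: "commute_op D C"
  shows "B (D x + X x) = 0"
proof -
  define \<theta> where "\<theta> = 3/4 * r"
  have Xx: "X x = A x - \<theta> *\<^sub>R x" for x by (simp add: X \<theta>_def blinfun.bilinear_simps)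
  note As = sym_opD[OF A] and Ds = sym_opD[OF pos_op_sym[OF D]] and Ms = sym_opD[OF pos_op_sym[OF M]]
    and Cs = sym_opD[OF pos_op_sym[OF C]]
  define g where "g = (1/2) *\<^sub>R (D + X)"
  have gx: "g x = (1/2) *\<^sub>R (D x + X x)" for x by (simp add: g_def blinfun.bilinear_simps)
  have DX: "D (X x) = X (D x)" for x
    using commute_opD[OF DA] by (simp add: Xx blinfun.bilinear_simps)
  \<comment> \<open>On the range of \<open>g\<close>, the operators \<open>X\<close>,
    \<open>D\<close> and \<open>g\<close> coincide. So \<open>A\<close> acts there as g + \<theta>,
    which is at least \<theta>.\<close>
  have Xg: "X (g x) = D (g x)" for x
    by (simp add: gx blinfun.bilinear_simps DX DD)
  have gg: "g (g x) = D (g x)" for x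
    by (simp add: gx[of "g x"] Xg flip: scaleR_2)
  have Ag: "A (g x) = g (g x) + \<theta> *\<^sub>R g x" for x
    using Xg[of x] gg[of x] by (simp add: Xx algebra_simps)
  have g_sym: "sym_op g"
    by (rule sym_opI) (simp add: gx Xx rinner_simps As Ds)
  note gs = sym_opD[OF g_sym]
  have g_pos: "pos_op g"
    by (rule pos_op_if_pos_on_range[OF g_sym]) (simp add: gg pos_opD[OF D])

  \<comment> \<open>The difference \<open>z\<close> again lies in the range of \<open>g\<close>,
    where \<open>A\<close> is at least \<theta>, yet Cz = - Az with \<open>C\<close> positive; both
    can hold only for z = 0.\<close>
  have Cg: "C (g x) = A (g x)" for x
  proof -
    define z where "z = C (g x) - A (g x)"
    have zg: "z = g (C x - A x)"
      using commute_opD[OF CA] commute_opD[OF DA] commute_opD[OF DC]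
      by (simp add: z_def gx Xx blinfun.bilinear_simps)
    have "C z = - A z"
      using commute_opD[OF CA] by (simp add: z_def blinfun.bilinear_simps CC)
    then have "A z \<bullet>\<^sub>R z \<le> 0" using pos_opD[OF C, of z] by (simp add: rinner_simps)
    moreover have "A z \<bullet>\<^sub>R z \<ge> \<theta> * (norm z)\<^sup>2"
      using pos_opD[OF g_pos, of z] Ag[of "C x - A x"] unfolding zg[symmetric]
      by (simp add: rinner_simps rinner_self)
    ultimately have "\<theta> * (norm z)\<^sup>2 \<le> 0" by linarith
    then have "z = 0" using r by (simp add: \<theta>_def mult_le_0_iff)
    then show ?thesis by (simp add: z_def)
  qed

  have M_sq: "(norm (M x))\<^sup>2 \<le> r * (M x \<bullet>\<^sub>R x)" for x
  proof (rule pos_op_sq_le[OF M])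
    fix x
    have nC: "norm (C y) = norm (A y)" for y
      using Cs[of y "C y"] As[of y "A y"] CC[of y]
      by (intro power2_eq_imp_eq[of "norm (C y)"]) (simp_all add: rinner_self)
    have "M (M x) \<bullet>\<^sub>R M x \<le> C (M x) \<bullet>\<^sub>R M x"
      using pos_opD[OF CM, of "M x"] by (simp add: blinfun.bilinear_simps rinner_simps)
    also have "\<dots> \<le> norm (C (M x)) * norm (M x)" using abs_rinner_le abs_le_D1 by blast
    also have "\<dots> \<le> (r * norm (M x)) * norm (M x)" unfolding nC by (intro mult_right_mono Ar) simp
    finally show "M (M x) \<bullet>\<^sub>R M x \<le> r * (norm (M x))\<^sup>2" by (simp add: power2_eq_square)
  qed

  \<comment> \<open>On its range \<open>g\<close> is A - \<theta>, and the bound \<open>r\<close>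
    for \<open>A\<close> leaves r - \<theta> = r/4.\<close>
  have g_norm: "norm (g x) \<le> r / 4 * norm x" for x
  proof (cases "g x = 0")
    case False
    have "(norm (g x))\<^sup>2 \<le> r / 4 * (g x \<bullet>\<^sub>R x)"
    proof (rule pos_op_sq_le[OF g_pos])
      fix x
      have "A (g x) \<bullet>\<^sub>R g x \<le> norm (A (g x)) * norm (g x)" using abs_rinner_le abs_le_D1 by blast
      also have "\<dots> \<le> (r * norm (g x)) * norm (g x)" by (intro mult_right_mono Ar) simp
      finally show "g (g x) \<bullet>\<^sub>R g x \<le> r / 4 * (norm (g x))\<^sup>2"
        by (simp add: Ag rinner_simps rinner_self \<theta>_def power2_eq_square)
    qed
    also have "\<dots> \<le> r / 4 * (norm (g x) * norm x)"
      using r abs_rinner_le abs_le_D1 by (intro mult_left_mono) auto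
    finally show ?thesis using False by (simp add: power2_eq_square)
  qed (use r in simp)

  \<comment> \<open>\<open>c\<close> extends \<open>A\<close> from the range of \<open>g\<close> to
    an operator bounded below by \<theta> on the whole space, and a = r - c has norm at most r/4.
    The gap between 3r/4 and r/4 drives the descent.\<close>
  define a where "a = (r / 4) *\<^sub>R id_blinfun - g"
  define c where "c = \<theta> *\<^sub>R id_blinfun + g"
  have ax: "a x = (r / 4) *\<^sub>R x - g x" for x by (simp add: a_def blinfun.bilinear_simps)
  have cg: "c x = \<theta> *\<^sub>R x + g x" for x by (simp add: c_def blinfun.bilinear_simps)
  have cx: "c x = r *\<^sub>R x - a x" for x
  proof -
    have "\<theta> *\<^sub>R x = r *\<^sub>R x - (r / 4) *\<^sub>R x" by (simp add: \<theta>_def flip: scaleR_diff_left)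
    then show ?thesis by (simp add: cg ax)
  qed
  have a_sym: "sym_op a" by (rule sym_opI) (simp add: ax rinner_simps gs)
  have c_sym: "sym_op c" by (rule sym_opI) (simp add: cg rinner_simps gs)
  note as = sym_opD[OF a_sym] and cs = sym_opD[OF c_sym]
  have ac: "a (c x) = c (a x)" for x by (simp add: cx blinfun.bilinear_simps)
  have a_norm: "norm (a x) \<le> r / 4 * norm x" for x
  proof (rule sym_op_norm_le[OF a_sym])
    fix x
    have "g x \<bullet>\<^sub>R x \<le> norm (g x) * norm x" using abs_rinner_le abs_le_D1 by blast
    also have "\<dots> \<le> (r / 4 * norm x) * norm x" by (intro mult_right_mono g_norm) simp
    finally show "\<bar>a x \<bullet>\<^sub>R x\<bar> \<le> r / 4 * (norm x)\<^sup>2"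
      using pos_opD[OF g_pos, of x]
      by (simp add: ax rinner_simps rinner_self power2_eq_square abs_le_iff)
  qed
  have a_le: "norm a \<le> r / 4" using r a_norm by (intro norm_blinfun_bound) auto
  have c_norm: "\<theta> * norm x \<le> norm (c x)" for x
    using norm_triangle_ineq2[of "r *\<^sub>R x" "a x"] a_norm[of x] r by (simp add: cx \<theta>_def)

  define B' where "B' = g o\<^sub>L B o\<^sub>L g"
  have B'x: "B' x = g (B (g x))" for x by (simp add: B'_def)
  have B'_skew: "skew_op B'" by (rule skew_opI) (simp add: B'x gs skew_opD[OF B])
  define n where "n y = M (g y) \<bullet>\<^sub>R g y" for y
  have n_nonneg: "0 \<le> n y" for y unfolding n_def by (rule pos_opD[OF M])

  \<comment> \<open>This is \<open>E\<close> at \<open>g y\<close>. As \<open>B'\<close> is skew and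
    c = r - a, the term in \<open>A\<close> becomes one in - a; expanding \<open>n (a y)\<close>
    turns the terms in \<open>M\<close> into a difference of \<open>n\<close> at \<open>c y\<close>
    and \<open>a y\<close>, up to M^2 \<le> rM.\<close>
  have key: "(norm (B (g y)))\<^sup>2 + (n (c y) - n (a y)) / r \<le> 2 * (a y \<bullet>\<^sub>R B' y)" for y
  proof -
    have Agy: "A (g y) = g (c y)" by (simp add: Ag cg blinfun.bilinear_simps)
    have "A (g y) \<bullet>\<^sub>R B (g y) = c y \<bullet>\<^sub>R B' y" by (simp add: Agy B'x gs)
    also have "\<dots> = - (a y \<bullet>\<^sub>R B' y)"
      using skew_op_self[OF B'_skew] by (simp add: cx rinner_simps)
    finally have "2 * (a y \<bullet>\<^sub>R B' y) = (norm (B (g y)))\<^sup>2 - (norm (M (g y)))\<^sup>2 + 2 * (g (c y) \<bullet>\<^sub>R M (g y))"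
      using E[of "g y"] by (simp add: Cg Agy)
    moreover have "(norm (M (g y)))\<^sup>2 \<le> r * n y" unfolding n_def by (rule M_sq)
    moreover have "n (c y) - n (a y) = r * (2 * (g (c y) \<bullet>\<^sub>R M (g y)) - r * n y)"
    proof -
      have ay: "a y = r *\<^sub>R y - c y" by (simp add: cx)
      have 1: "M (g y) \<bullet>\<^sub>R g (c y) = g (c y) \<bullet>\<^sub>R M (g y)" by (rule rinner_commute)
      have 2: "M (g (c y)) \<bullet>\<^sub>R g y = g (c y) \<bullet>\<^sub>R M (g y)" by (rule Ms)
      show ?thesis
        unfolding n_def ay blinfun.bilinear_simps rinner_simps 1 2 by (simp add: algebra_simps)
    qed
    then have "(n (c y) - n (a y)) / r = 2 * (g (c y) \<bullet>\<^sub>R M (g y)) - r * n y" using r by simp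
    ultimately show ?thesis by linarith
  qed

  obtain K where K: "skew_op K" and K_eq: "\<And>x. r\<^sup>2 *\<^sub>R K x = B' x + r *\<^sub>R (a (K x) + K (a x))"
    using lyapunov_skew_solution[OF a_sym a_le B'_skew r] by blast
  have B'_eq: "B' y = c (K (c y)) - a (K (a y))" for y
  proof -
    have "B' y = r\<^sup>2 *\<^sub>R K y - r *\<^sub>R (a (K y) + K (a y))" by (simp add: K_eq)
    then show ?thesis
      by (simp add: cx blinfun.bilinear_simps power2_eq_square algebra_simps)
  qed
  \<comment> \<open>The purpose of \<open>K\<close>: the right side of \<open>key\<close> also
    becomes a difference of one form at \<open>c y\<close> and \<open>a y\<close>.\<close>
  have Q: "a (c y) \<bullet>\<^sub>R K (c y) - a (a y) \<bullet>\<^sub>R K (a y) = a y \<bullet>\<^sub>R B' y" for y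
    by (simp add: B'_eq rinner_simps ac as cs)

  \<comment> \<open>By \<open>key\<close> and \<open>Q\<close>, S(cy) - S(ay) is at least |Bgy|^2 +
    |Kay|^2 - |Kcy|^2, which is shown to be nonnegative below.\<close>
  define S where "S u = 2 * (a u \<bullet>\<^sub>R K u) - n u / r - (norm (K u))\<^sup>2" for u
  define k where "k = 2 * (norm a * norm K) + norm M * (norm g)\<^sup>2 / r + (norm K)\<^sup>2"
  have S_nonneg: "0 \<le> S u" for u
  proof (rule quadratic_nonneg_by_descent[where S = S and k = k])
    show "- k * (norm u)\<^sup>2 \<le> S u" for u
    proof -
      have "\<bar>a u \<bullet>\<^sub>R K u\<bar> \<le> (norm a * norm u) * (norm K * norm u)"
        by (intro order_trans[OF abs_rinner_le] mult_mono norm_blinfun) auto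
      then have 1: "- (2 * (norm a * norm K) * (norm u)\<^sup>2) \<le> 2 * (a u \<bullet>\<^sub>R K u)"
        by (simp add: abs_le_iff power2_eq_square mult_ac)
      have "n u \<le> norm (M (g u)) * norm (g u)" unfolding n_def using abs_rinner_le abs_le_D1 by blast
      also have "\<dots> \<le> (norm M * (norm g * norm u)) * (norm g * norm u)"
        by (intro mult_mono order_trans[OF norm_blinfun] mult_left_mono norm_blinfun) auto
      finally have "n u / r \<le> norm M * (norm g)\<^sup>2 / r * (norm u)\<^sup>2"
        using r by (simp add: field_simps power2_eq_square)
      moreover have "(norm (K u))\<^sup>2 \<le> (norm K)\<^sup>2 * (norm u)\<^sup>2"
        by (metis norm_blinfun norm_ge_zero power_mono power_mult_distrib)
      ultimately show ?thesis using 1 unfolding S_def k_def by (simp only: distrib_right minus_add_distrib minus_mult_left[symmetric])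
    qed
    show "\<exists>v. norm v \<le> norm u / 2 \<and> S v \<le> S u" for u
    proof -
      \<comment> \<open>Every \<open>u\<close> has the form \<open>c y\<close>; the descent passes
        to \<open>a y\<close>, shorter by at least a factor 3.\<close>
      obtain y where y: "c y = u" unfolding cx using surj_perturbation[OF a_le r] .
      define s where "s = norm (B (g y))"
      define t where "t = norm (K (a y))"
      \<comment> \<open>The lower bound \<theta> for \<open>c\<close> is three times the bound r/4
        for \<open>a\<close> and \<open>g\<close>, hence the factor 1/3 below.\<close>
      have "\<theta> * norm (K u) \<le> norm (c (K u))" by (rule c_norm)
      also have "c (K u) = B' y + a (K (a y))" by (simp add: B'_eq y)
      also have "norm \<dots> \<le> r / 4 * s + r / 4 * t"
        unfolding B'x s_def t_def by (intro order_trans[OF norm_triangle_ineq] add_mono g_norm a_norm)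
      finally have "r * (3 * norm (K u)) \<le> r * (s + t)" by (simp add: \<theta>_def field_simps)
      then have "norm (K u) \<le> (1/3) * (s + t)" using r by simp
      then have "(norm (K u))\<^sup>2 \<le> ((1/3) * (s + t))\<^sup>2" by (intro power_mono) auto
      also have "\<dots> = (1/9) * (s\<^sup>2 + t\<^sup>2 + 2 * s * t)" by (simp add: power2_eq_square field_simps)
      also have "\<dots> \<le> s\<^sup>2 + t\<^sup>2"
        using sum_squares_bound[of s t] zero_le_power2[of s] zero_le_power2[of t] by argo
      finally have "S (a y) \<le> S u"
        using key[of y] Q[of y] unfolding S_def y s_def t_def by (simp add: diff_divide_distrib)
      moreover have "norm (a y) \<le> norm u / 2"
      proof -
        have "4 * norm (a y) \<le> r * norm y" using a_norm[of y] by simp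
        moreover have "3 * (r * norm y) \<le> 4 * norm u" using c_norm[of y] by (simp add: y \<theta>_def)
        ultimately show ?thesis using norm_ge_zero[of u] by linarith
      qed
      ultimately show ?thesis by blast
    qed
  qed
  \<comment> \<open>Dropping the nonnegative \<open>n u / r\<close> from \<open>S u \<ge> 0\<close>
    leaves the inequality of \<open>skew_op_riccati_zero\<close>. With K = 0 the same inequality
    forces n = 0, and \<open>key\<close> then kills \<open>B (g x)\<close>.\<close>
  have "K = 0"
  proof (rule skew_op_riccati_zero[OF a_sym K])
    show "(norm (K u))\<^sup>2 \<le> 2 * (a u \<bullet>\<^sub>R K u)" for u
      using S_nonneg[of u] n_nonneg[of u] r unfolding S_def by (smt (verit) divide_nonneg_pos)
  qed
  then have n0: "n u = 0" for u
    using S_nonneg[of u] n_nonneg[of u] r by (simp add: S_def divide_le_0_iff)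
  have "B' y = 0" for y using \<open>K = 0\<close> by (simp add: B'_eq blinfun.bilinear_simps)
  then have "B (g x) = 0" using key[of x] by (simp add: n0)
  then show ?thesis by (simp add: gx blinfun.bilinear_simps)
qed

text \<open>By uniqueness \<open>P\<close> is the constructed root of its square, so it inherits the
  commutation clause.\<close>

lemma pos_op_commute:
  fixes P X :: "'a::chilbert_space \<Rightarrow>\<^sub>L 'a"
  assumes P: "pos_op P" and X: "\<And>x. X (P (P x)) = P (P (X x))"
  shows "commute_op X P"
proof -
  have "pos_op (P o\<^sub>L P)" by (rule pos_op_square[OF pos_op_sym[OF P]])
  then obtain Q where Q: "pos_op Q" "\<And>x. Q (Q x) = (P o\<^sub>L P) x"
    "\<And>Y. commute_op Y (P o\<^sub>L P) \<Longrightarrow> commute_op Y Q"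
    by (rule pos_op_sqrt_exists) blast
  have "commute_op P Q" by (rule Q(3)) (simp add: commute_op_def)
  then have "P = Q" using P Q(1,2) by (intro pos_op_sqrt_unique) auto
  moreover have "commute_op X Q" by (rule Q(3)) (simp add: commute_op_def X)
  ultimately show ?thesis by simp
qed

lemma pos_op_compose_projection:
  fixes F G :: "'a::chilbert_space \<Rightarrow>\<^sub>L 'a"
  assumes G: "pos_op G" and F: "sym_op F" "\<And>x. F (F x) = F x" and comm: "commute_op F G"
  shows "pos_op (G o\<^sub>L F)"
proof -
  note Fs = sym_opD[OF F(1)] and Gs = sym_opD[OF pos_op_sym[OF G]] and c = commute_opD[OF comm]
  have "0 \<le> G (F x) \<bullet>\<^sub>R x" for x
    using pos_opD[OF G, of "F x"] by (metis F(2) Fs c)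
  moreover have "G (F x) \<bullet>\<^sub>R y = x \<bullet>\<^sub>R G (F y)" for x y
    by (simp add: Gs Fs c)
  ultimately show ?thesis by (auto simp: pos_op_def intro!: sym_opI)
qed

text \<open>Invariance says FAF = AF; taking adjoints gives FAF = FA.\<close>

lemma projection_commutes_if_invariant:
  fixes F A :: "'a::chilbert_space \<Rightarrow>\<^sub>L 'a"
  assumes F: "sym_op F" "\<And>x. F x \<in> S" "\<And>x. x \<in> S \<Longrightarrow> F x = x"
    and A: "sym_op A" and inv: "\<And>x. x \<in> S \<Longrightarrow> A x \<in> S"
  shows "commute_op A F"
  unfolding commute_op_def
proof (intro allI rinner_ext)
  fix x z
  have FAF: "F (A (F u)) = A (F u)" for u by (simp add: F inv)
  have "z \<bullet>\<^sub>R F (A x) = F (A (F z)) \<bullet>\<^sub>R x"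
    by (simp add: FAF sym_opD[OF F(1)] sym_opD[OF A])
  also have "\<dots> = z \<bullet>\<^sub>R F (A (F x))"
    by (simp add: sym_opD[OF F(1)] sym_opD[OF A])
  finally show "z \<bullet>\<^sub>R A (F x) = z \<bullet>\<^sub>R F (A x)" by (simp add: FAF)
qed

theorem skew_part_vanishes:
  fixes A B C P :: "'a::chilbert_space \<Rightarrow>\<^sub>L 'a"
  assumes A: "sym_op A" and B: "skew_op B"
    and C: "pos_op C" and CC: "\<And>x. C (C x) = A (A x)"
    and P: "pos_op P" and PP: "\<And>x. P (P x) = (A - B) ((A + B) x)"
    and le: "pos_op (C - P)"
  shows "B = 0"
proof -
  note As = sym_opD[OF A] and Bs = skew_opD[OF B] and Cs = sym_opD[OF pos_op_sym[OF C]]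
    and Ps = sym_opD[OF pos_op_sym[OF P]]
  \<comment> \<open>As an intersection of kernels of B A^n, this is closed and invariant under
    \<open>A\<close>; the case n = 0 puts it inside the kernel of \<open>B\<close>.\<close>
  define E where "E = {x. \<forall>n. B ((blinfun_apply A ^^ n) x) = 0}"
  have lin: "bounded_linear (blinfun_apply A ^^ n)" for n
  proof (induction n)
    case (Suc n)
    then show ?case
      using bounded_linear_compose[OF blinfun.bounded_linear_right[of A]] by (simp add: o_def)
  qed (simp add: id_def)
  have "subspace E"
    unfolding E_def subspace_def
    using linear_add[OF bounded_linear.linear[OF lin]] linear_scale[OF bounded_linear.linear[OF lin]]
      linear_0[OF bounded_linear.linear[OF lin]]
    by (simp add: blinfun.bilinear_simps)
  moreover have "closed E"
    unfolding E_def
    by (intro closed_Collect_all closed_Collect_eq continuous_intros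
        blinfun.continuous_on[OF continuous_on_const] linear_continuous_on lin)
  ultimately obtain F0 where F0: "sym_op F0" "\<And>x. F0 x \<in> E" "\<And>x. x \<in> E \<Longrightarrow> F0 x = x"
    using projection_exists by metis
  have AE: "A x \<in> E" if "x \<in> E" for x
  proof -
    have "B ((blinfun_apply A ^^ n) (A x)) = B ((blinfun_apply A ^^ Suc n) x)" for n
      by (simp add: funpow_swap1)
    with that show ?thesis by (simp only: E_def mem_Collect_eq) simp
  qed
  have BE: "B x = 0" if "x \<in> E" for x
    using that unfolding E_def mem_Collect_eq by (metis funpow_0)
  define F where "F = id_blinfun - F0"
  have Fx: "F x = x - F0 x" for x by (simp add: F_def blinfun.bilinear_simps)
  have F_sym: "sym_op F" using sym_opD[OF F0(1)] by (auto intro!: sym_opI simp: Fx rinner_simps)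
  note Fs = sym_opD[OF F_sym]
  have FF: "F (F x) = F x" for x using F0 by (simp add: Fx blinfun.bilinear_simps)
  have FE: "F x = 0" if "x \<in> E" for x using F0(3)[OF that] by (simp add: Fx)
  have F_norm: "F x \<bullet>\<^sub>R x \<le> (norm x)\<^sup>2" for x
  proof -
    have "F0 x \<bullet>\<^sub>R x = F0 x \<bullet>\<^sub>R F0 x"
      using sym_opD[OF F0(1), of "F0 x" x] F0(2,3) by simp
    then show ?thesis by (simp add: Fx rinner_simps rinner_self)
  qed
  have AF: "A (F x) = F (A x)" for x
    using commute_opD[OF projection_commutes_if_invariant[OF F0 A AE]] by (simp add: Fx blinfun.bilinear_simps)
  have BF: "B (F x) = B x" for x using BE F0(2) by (simp add: Fx blinfun.bilinear_simps)
  have FB: "F (B x) = B x" for x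
  proof (rule rinner_ext)
    fix z
    have "z \<bullet>\<^sub>R F (B x) = - (B (F z) \<bullet>\<^sub>R x)" by (simp add: Bs Fs)
    then show "z \<bullet>\<^sub>R F (B x) = z \<bullet>\<^sub>R B x" by (simp add: BF Bs)
  qed
  have CF: "commute_op F C" by (rule pos_op_commute[OF C]) (simp add: CC AF)
  have CA: "commute_op A C" by (rule pos_op_commute[OF C]) (simp add: CC)
  have PF: "commute_op F P"
  proof (rule pos_op_commute[OF P])
    fix x
    have "B (A (F x)) = B (A x)" by (simp add: AF BF)
    then show "F (P (P x)) = P (P (F x))"
      by (simp add: PP blinfun.bilinear_simps BF FB AF[symmetric])
  qed
  \<comment> \<open>\<open>A\<close>, \<open>C\<close> and \<open>P\<close> commute with
    \<open>F\<close>, and BF = FB = B. Composing with \<open>F\<close> therefore restricts the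
    problem to the complement of \<open>E\<close> without leaving the space.\<close>
  define A1 where "A1 = A o\<^sub>L F"
  define C1 where "C1 = C o\<^sub>L F"
  define M1 where "M1 = (C - P) o\<^sub>L F"
  have A1x: "A1 x = A (F x)" and C1x: "C1 x = C (F x)" and M1x: "M1 x = C (F x) - P (F x)" for x
    by (simp_all add: A1_def C1_def M1_def blinfun.bilinear_simps)
  have A1_sym: "sym_op A1" by (rule sym_opI) (simp add: A1x As Fs AF)
  have C1_pos: "pos_op C1" unfolding C1_def by (rule pos_op_compose_projection[OF C F_sym FF CF])
  have M1_pos: "pos_op M1" unfolding M1_def
    by (rule pos_op_compose_projection[OF le F_sym FF])
      (use CF PF in \<open>simp add: commute_op_def blinfun.bilinear_simps\<close>)
  have CM_pos: "pos_op (C1 - M1)"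
  proof -
    have "C1 - M1 = P o\<^sub>L F" by (rule blinfun_eqI) (simp add: C1x M1x blinfun.bilinear_simps)
    then show ?thesis using pos_op_compose_projection[OF P F_sym FF PF] by simp
  qed
  have CC1: "C1 (C1 x) = A1 (A1 x)" for x
    using commute_opD[OF CF] by (simp add: C1x A1x CC AF FF)
  have CA1: "commute_op C1 A1"
    using commute_opD[OF CF] commute_opD[OF CA] by (simp add: commute_op_def C1x A1x AF)
  \<comment> \<open>On the range of \<open>F\<close>, |Py| = |Ay + By| and |Cy| = |Ay|; with P = C -
    M, expand both squares.\<close>
  have rel: "(norm (B x))\<^sup>2 + 2 * (A1 x \<bullet>\<^sub>R B x) = (norm (M1 x))\<^sup>2 - 2 * (C1 x \<bullet>\<^sub>R M1 x)" for x
  proof -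
    define y where "y = F x"
    have "(norm (P y))\<^sup>2 = y \<bullet>\<^sub>R P (P y)" by (simp add: Ps flip: rinner_self)
    also have "\<dots> = (norm (A y + B y))\<^sup>2"
      by (simp add: PP blinfun.bilinear_simps rinner_simps As Bs flip: rinner_self)
    finally have "(norm (C1 x - M1 x))\<^sup>2 = (norm (A1 x + B x))\<^sup>2"
      by (simp add: C1x M1x A1x y_def BF)
    moreover have "(norm (C1 x))\<^sup>2 = (norm (A1 x))\<^sup>2"
      using CC1 by (simp add: sym_opD[OF A1_sym] sym_opD[OF pos_op_sym[OF C1_pos]] flip: rinner_self)
    ultimately show ?thesis by (simp add: norm_diff_sq norm_add_sq)
  qed

  have shrink: "norm (A1 x) \<le> 3/4 * r * norm x"
    if r: "r > 0" and bd: "\<And>x. norm (A1 x) \<le> r * norm x" for r x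
  proof (rule sym_op_norm_le[OF A1_sym])
    \<comment> \<open>The hypotheses are stable under changing the signs of \<open>A\<close> and
      \<open>B\<close> together, so \<open>s\<close> treats the windows at both ends of the
      spectrum.\<close>
    have *: "s * (A1 x \<bullet>\<^sub>R x) \<le> 3/4 * r * (norm x)\<^sup>2" if s: "s = 1 \<or> s = -1" for s x
    proof -
      have ss: "s * s = 1" "\<bar>s\<bar> = 1" using s by auto
      define X where "X = s *\<^sub>R A1 - (3/4 * r) *\<^sub>R id_blinfun"
      have Xx: "X y = s *\<^sub>R A1 y - (3/4 * r) *\<^sub>R y" for y by (simp add: X_def blinfun.bilinear_simps)
      have "sym_op X" by (rule sym_opI) (simp add: Xx rinner_simps sym_opD[OF A1_sym])
      then have "pos_op (X o\<^sub>L X)" by (rule pos_op_square)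
      then obtain D where D: "pos_op D" "\<And>x. D (D x) = (X o\<^sub>L X) x"
        "\<And>Y. commute_op Y (X o\<^sub>L X) \<Longrightarrow> commute_op Y D"
        by (rule pos_op_sqrt_exists) blast
      have D_comm: "Y (D y) = D (Y y)" if "\<And>y. Y (A1 y) = A1 (Y y)" for y and Y :: "'a \<Rightarrow>\<^sub>L 'a"
      proof -
        have "commute_op Y (X o\<^sub>L X)" by (simp add: commute_op_def Xx blinfun.bilinear_simps that)
        then show ?thesis using D(3) commute_opD by blast
      qed
      have Bh: "B (D y + X y) = 0" for y
      proof -
        have "(s *\<^sub>R B) (D y + X y) = 0"
        proof (rule skew_part_vanishes_on_spectral_window[where A = "s *\<^sub>R A1" and C = C1 and M = M1 and r = r])
          show "sym_op (s *\<^sub>R A1)" "skew_op (s *\<^sub>R B)"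
            by (auto intro!: sym_opI skew_opI simp: blinfun.bilinear_simps rinner_simps sym_opD[OF A1_sym] Bs)
          show "C1 (C1 x) = (s *\<^sub>R A1) ((s *\<^sub>R A1) x)" for x
            using ss by (simp add: CC1 blinfun.bilinear_simps)
          show "commute_op C1 (s *\<^sub>R A1)" "commute_op D (s *\<^sub>R A1)" "commute_op D C1"
            using CA1 D_comm[of A1] D_comm[of C1] by (auto simp: commute_op_def blinfun.bilinear_simps)
          show "norm ((s *\<^sub>R A1) x) \<le> r * norm x" for x
            using bd ss by (simp add: blinfun.bilinear_simps)
          show "(norm ((s *\<^sub>R B) x))\<^sup>2 + 2 * ((s *\<^sub>R A1) x \<bullet>\<^sub>R (s *\<^sub>R B) x) = (norm (M1 x))\<^sup>2 - 2 * (C1 x \<bullet>\<^sub>R M1 x)" for x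
            using rel[of x] s by (elim disjE) (simp_all add: blinfun.bilinear_simps rinner_simps)
          show "D (D x) = X (X x)" for x by (simp add: D(2))
        qed (fact C1_pos M1_pos CM_pos r X_def D(1))+
        then show ?thesis using s by (auto simp: blinfun.scaleR_left)
      qed
      have AA1: "A (A1 y) = A1 (A y)" for y by (simp add: A1x AF)
      have "(blinfun_apply A ^^ n) (D y + X y) = D ((blinfun_apply A ^^ n) y) + X ((blinfun_apply A ^^ n) y)" for n y
        by (induction n) (simp_all add: blinfun.bilinear_simps Xx D_comm[of A, OF AA1] AA1)
      \<comment> \<open>\<open>D\<close> and \<open>X\<close> commute with \<open>A\<close>, so the
        range of D + X is killed by each B A^n. Thus F X = - F D is nonpositive, which bounds the
        form of s A1 by 3r/4.\<close>
      then have "D y + X y \<in> E" for y by (simp add: E_def Bh)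
      then have "F (D x + X x) = 0" by (rule FE)
      then have "F (D x) + s *\<^sub>R A1 x - (3/4 * r) *\<^sub>R F x = 0"
        by (simp add: Xx blinfun.bilinear_simps A1x AF FF add_diff_eq)
      then have "(F (D x) + s *\<^sub>R A1 x - (3/4 * r) *\<^sub>R F x) \<bullet>\<^sub>R x = 0" by simp
      then have eq: "F (D x) \<bullet>\<^sub>R x + s * (A1 x \<bullet>\<^sub>R x) = 3/4 * r * (F x \<bullet>\<^sub>R x)"
        by (simp add: rinner_simps)
      have "F (D x) = D (F x)" using D_comm[of F] by (simp add: A1x AF)
      then have "F (D x) \<bullet>\<^sub>R x = D (F x) \<bullet>\<^sub>R F x" by (metis FF Fs)
      then have "0 \<le> F (D x) \<bullet>\<^sub>R x" using pos_opD[OF D(1)] by simp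
      moreover have "3/4 * r * (F x \<bullet>\<^sub>R x) \<le> 3/4 * r * (norm x)\<^sup>2"
        using r by (intro mult_left_mono F_norm) auto
      ultimately show ?thesis using eq by linarith
    qed
    show "\<bar>A1 x \<bullet>\<^sub>R x\<bar> \<le> 3/4 * r * (norm x)\<^sup>2" for x
      using *[of 1 x] *[of "-1" x] by (simp add: abs_le_iff)
  qed
  \<comment> \<open>The added 1 keeps the starting bound positive, as \<open>shrink\<close>
    requires, even when A1 = 0.\<close>
  have "norm (A1 x) \<le> (3/4)^n * (norm A1 + 1) * norm x" for n x
  proof (induction n arbitrary: x)
    case 0
    show ?case using norm_blinfun[of A1 x] by (simp add: distrib_right add_increasing2)
  next
    case (Suc n)
    show ?case using shrink[of "(3/4)^n * (norm A1 + 1)"] Suc by (simp add: add_nonneg_pos mult.assoc)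
  qed
  moreover have "(\<lambda>n. (3/4)^n * (norm A1 + 1) * norm x) \<longlonglongrightarrow> 0 * (norm A1 + 1) * norm x" for x
    by (intro tendsto_intros LIMSEQ_power_zero) auto
  ultimately have "norm (A1 x) \<le> 0" for x
    by (intro LIMSEQ_le_const[where X = "\<lambda>n. (3/4)^n * (norm A1 + 1) * norm x"]) auto
  then have A1_0: "A (F x) = 0" for x by (simp add: A1x)
  show "B = 0"
  proof (rule blinfun_eqI)
    fix x
    \<comment> \<open>Where \<open>A\<close> vanishes so does \<open>C\<close>; then C - P \<ge> 0
      forces P = 0, and the formula for P^2 leaves |Bx|^2 = 0.\<close>
    have "(norm (C (F x)))\<^sup>2 = 0"
      by (simp add: Cs CC A1_0 flip: rinner_self)
    then have "P (F x) \<bullet>\<^sub>R F x \<le> 0"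
      using pos_opD[OF le, of "F x"] by (simp add: blinfun.bilinear_simps rinner_simps)
    then have "P (F x) = 0" using pos_op_eq_zero[OF P] pos_opD[OF P] by (metis antisym)
    then have "(A - B) ((A + B) (F x)) \<bullet>\<^sub>R F x = 0" by (simp flip: PP)
    then have "(norm (B x))\<^sup>2 = 0"
      using Bs[of "B x" "F x"] by (simp add: blinfun.bilinear_simps A1_0 BF rinner_simps As rinner_self)
    then show "blinfun_apply B x = blinfun_apply 0 x" by simp
  qed
qed

section \<open>Complex-linear operators\<close>

lemma norm_scaleC_ii: "norm (\<i> *\<^sub>C x) = norm x" for x :: "'a::chilbert_space"
proof -
  have "cinner (\<i> *\<^sub>C x) (\<i> *\<^sub>C x) = \<i> * cnj (cinner (\<i> *\<^sub>C x) x)"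
    by (subst cinner_scaleC_left) (metis cinner_commute)
  also have "\<dots> = cinner x x" by (simp add: cinner_scaleC_left cinner_norm)
  finally have "complex_of_real ((norm (\<i> *\<^sub>C x))\<^sup>2) = complex_of_real ((norm x)\<^sup>2)"
    by (simp only: cinner_norm)
  then show ?thesis by (simp del: of_real_power)
qed

text \<open>For bounded real-linear operators, complex linearity becomes commutation with
  \<open>ii_op\<close>, a property that adjoints and constructed square roots inherit.\<close>

lift_definition ii_op :: "'a::chilbert_space \<Rightarrow>\<^sub>L 'a" is "\<lambda>x. \<i> *\<^sub>C x"
proof (rule bounded_linear_intro[where K = 1])
  show "\<i> *\<^sub>C (x + y) = \<i> *\<^sub>C x + \<i> *\<^sub>C y" for x y :: 'a by (rule scaleC_add_right)
  show "\<i> *\<^sub>C (r *\<^sub>R x) = r *\<^sub>R \<i> *\<^sub>C x" for r and x :: 'a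
    by (simp add: scaleR_scaleC scaleC_scaleC mult.commute)
qed (simp add: norm_scaleC_ii)

text \<open>The product is conjugate-linear in its second argument, so \<i> leaves it as - \<i>.
  Complex identities thus split into two real ones.\<close>

lemma Im_cinner: "Im (cinner x y) = x \<bullet>\<^sub>R ii_op y"
proof -
  have "cinner x (\<i> *\<^sub>C y) = cnj (\<i> * cinner y x)"
    by (metis cinner_commute cinner_scaleC_left)
  also have "\<dots> = - \<i> * cinner x y" by (metis cinner_commute complex_cnj_i complex_cnj_mult)
  finally show ?thesis by (simp add: rinner_def ii_op.rep_eq)
qed

lemma skew_ii_op: "skew_op (ii_op :: 'a::chilbert_space \<Rightarrow>\<^sub>L 'a)"
proof (rule skew_opI)
  show "ii_op x \<bullet>\<^sub>R y = - (x \<bullet>\<^sub>R ii_op y)" for x y :: 'a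
    by (simp flip: Im_cinner) (simp add: rinner_def ii_op.rep_eq cinner_scaleC_left)
qed

lemma cinner_eq_iff: "cinner x y = cinner u v \<longleftrightarrow> x \<bullet>\<^sub>R y = u \<bullet>\<^sub>R v \<and> x \<bullet>\<^sub>R ii_op y = u \<bullet>\<^sub>R ii_op v"
  by (simp add: complex_eq_iff Im_cinner flip: rinner_def)

lemma cinner_eq_0_iff: "cinner x y = 0 \<longleftrightarrow> x \<bullet>\<^sub>R y = 0 \<and> x \<bullet>\<^sub>R ii_op y = 0"
  by (simp add: complex_eq_iff Im_cinner flip: rinner_def)

lemma ii_op_ii_op: "ii_op (ii_op x) = - x"
proof -
  have "ii_op (ii_op x) = complex_of_real (-1) *\<^sub>C x" by (simp add: ii_op.rep_eq scaleC_scaleC)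
  then show ?thesis by (simp only: flip: scaleR_scaleC) simp
qed

lemma scaleC_conv_ii_op: "a *\<^sub>C x = Re a *\<^sub>R x + Im a *\<^sub>R ii_op x"
proof -
  have "Im a *\<^sub>R ii_op x = (complex_of_real (Im a) * \<i>) *\<^sub>C x"
    by (simp add: ii_op.rep_eq scaleR_scaleC scaleC_scaleC)
  moreover have "a = complex_of_real (Re a) + complex_of_real (Im a) * \<i>"
    by (simp add: complex_eq_iff)
  ultimately show ?thesis by (metis scaleC_add_left scaleR_scaleC)
qed

section \<open>Adjoint, square root and modulus of complex-linear operators on the whole
  space\<close>

lemma bounded_op_on_UNIV_obtain:
  assumes "bounded_op_on UNIV T"
  obtains t where "T = blinfun_apply t" "commute_op ii_op t"
proof -
  from assms have add: "T (x + y) = T x + T y" and scale: "T (a *\<^sub>C x) = a *\<^sub>C T x" for x y a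
    by (auto simp: bounded_op_on_def)
  from assms obtain K where K: "\<And>x. norm (T x) \<le> K * norm x" by (auto simp: bounded_op_on_def)
  have "bounded_linear T"
    using K by (intro bounded_linear_intro[where K = K]) (auto simp: add scale scaleR_scaleC mult.commute)
  then have T: "blinfun_apply (Blinfun T) = T" by (rule bounded_linear_Blinfun_apply)
  show ?thesis
    by (rule that[of "Blinfun T"]) (simp_all add: commute_op_def T ii_op.rep_eq scale)
qed

lemma bounded_op_on_blinfun:
  assumes "commute_op ii_op t" "\<And>x. x \<in> S \<Longrightarrow> t x \<in> S"
  shows "bounded_op_on S (blinfun_apply t)"
  unfolding bounded_op_on_def
  using assms norm_blinfun[of t]
  by (auto simp: blinfun.bilinear_simps scaleC_conv_ii_op commute_op_def)

lemma adjoint_on_eqI: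
  assumes S: "closed_csubspace S" and z: "z \<in> S" "\<And>x. x \<in> S \<Longrightarrow> cinner (T x) y = cinner x z"
  shows "adjoint_on S T y = z"
  unfolding adjoint_on_def
proof (rule the_equality)
  fix z' assume z': "z' \<in> S \<and> (\<forall>x\<in>S. cinner (T x) y = cinner x z')"
  have "z' + (-1) *\<^sub>C z \<in> S" using S z(1) z' by (auto simp: closed_csubspace_def)
  then have d: "z' - z \<in> S" by (simp add: scaleC_conv_ii_op)
  have "(z' - z) \<bullet>\<^sub>R z' = (z' - z) \<bullet>\<^sub>R z"
    using z(2)[OF d] z' d by (simp add: rinner_def)
  then have "(z' - z) \<bullet>\<^sub>R (z' - z) = 0" by (simp add: rinner_simps)
  then show "z' = z" by (simp add: rinner_self)
qed (use z in auto)

lemma closed_csubspace_UNIV: "closed_csubspace UNIV"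
  by (simp add: closed_csubspace_def)

lemma adjoint_commutes_ii_op:
  assumes "is_adjoint t s" "commute_op ii_op t"
  shows "commute_op ii_op s"
  unfolding commute_op_def
proof (intro allI rinner_ext)
  fix y z
  have ts: "t u \<bullet>\<^sub>R v = u \<bullet>\<^sub>R s v" for u v using assms(1) by (simp add: is_adjoint_def)
  have "z \<bullet>\<^sub>R ii_op (s y) = - (t (ii_op z) \<bullet>\<^sub>R y)" by (simp add: skew_opD[OF skew_ii_op] ts)
  also have "\<dots> = z \<bullet>\<^sub>R s (ii_op y)"
    by (simp add: skew_opD[OF skew_ii_op] ts flip: commute_opD[OF assms(2)])
  finally show "z \<bullet>\<^sub>R ii_op (s y) = z \<bullet>\<^sub>R s (ii_op y)" .
qed

lemma adjoint_on_UNIV_blinfun: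
  assumes "is_adjoint t s" "commute_op ii_op t"
  shows "adjoint_on UNIV (blinfun_apply t) = blinfun_apply s"
proof
  fix y
  show "adjoint_on UNIV t y = s y"
    using assms adjoint_commutes_ii_op[OF assms]
    by (intro adjoint_on_eqI closed_csubspace_UNIV) (auto simp: cinner_eq_iff is_adjoint_def commute_op_def)
qed

text \<open>Symmetry comes from polarising the vanishing imaginary part of the form at
  \<open>x\<close> and \<open>ii_op y\<close>, together with complex linearity.\<close>

lemma pos_op_of_positive_on_UNIV:
  assumes "positive_on UNIV (blinfun_apply b)" "commute_op ii_op b"
  shows "pos_op b"
  unfolding pos_op_def
proof
  show "\<forall>x. 0 \<le> b x \<bullet>\<^sub>R x" using assms(1) by (simp add: positive_on_def rinner_def)
  have im: "b x \<bullet>\<^sub>R ii_op x = 0" for x using assms(1) by (simp add: positive_on_def Im_cinner)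
  show "sym_op b"
  proof (rule sym_opI)
    fix x y
    have "b x \<bullet>\<^sub>R ii_op (ii_op y) + b (ii_op y) \<bullet>\<^sub>R ii_op x = 0"
      using im[of "x + ii_op y"] im[of x] im[of "ii_op y"] by (simp add: blinfun.bilinear_simps rinner_simps)
    moreover have "b (ii_op y) \<bullet>\<^sub>R ii_op x = b y \<bullet>\<^sub>R x"
      by (simp add: skew_opD[OF skew_ii_op] ii_op_ii_op rinner_simps flip: commute_opD[OF assms(2)])
    ultimately show "b x \<bullet>\<^sub>R y = x \<bullet>\<^sub>R b y" by (simp add: ii_op_ii_op rinner_simps rinner_commute)
  qed
qed

lemma positive_on_UNIV_of_pos_op:
  assumes "pos_op b" "commute_op ii_op b"
  shows "positive_on UNIV (blinfun_apply b)"
proof -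
  have "b x \<bullet>\<^sub>R ii_op x = - (b x \<bullet>\<^sub>R ii_op x)" for x
    using skew_opD[OF skew_ii_op, of "b x" x] commute_opD[OF assms(2), of x]
      sym_opD[OF pos_op_sym[OF assms(1)], of "ii_op x" x]
    by (simp add: rinner_commute)
  then have "b x \<bullet>\<^sub>R ii_op x = 0" for x by (metis equal_neg_zero)
  then show ?thesis
    using pos_opD[OF assms(1)] bounded_op_on_blinfun[OF assms(2)]
    by (simp add: positive_on_def Im_cinner flip: rinner_def)
qed

text \<open>Any competing root commutes with its square \<open>a\<close>, hence with the constructed
  root, so \<open>pos_op_sqrt_unique\<close> settles the definite description.\<close>

lemma sqrt_on_UNIV_blinfun:
  assumes a: "pos_op a" "commute_op ii_op a"
  obtains b where "sqrt_on UNIV (blinfun_apply a) = blinfun_apply b" "pos_op b"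
    "commute_op ii_op b" "\<And>x. b (b x) = a x"
proof -
  obtain b where b: "pos_op b" "\<And>x. b (b x) = a x" "\<And>X. commute_op X a \<Longrightarrow> commute_op X b"
    using pos_op_sqrt_exists[OF a(1)] by blast
  have ib: "commute_op ii_op b" by (rule b(3)[OF a(2)])
  have "sqrt_on UNIV (blinfun_apply a) = blinfun_apply b"
    unfolding sqrt_on_def
  proof (rule the_equality)
    show "positive_on UNIV b \<and> (\<forall>x\<in>UNIV. b (b x) = a x) \<and> (\<forall>x. x \<notin> UNIV \<longrightarrow> b x = 0)"
      using positive_on_UNIV_of_pos_op[OF b(1) ib] b(2) by simp
    fix B assume B: "positive_on UNIV B \<and> (\<forall>x\<in>UNIV. B (B x) = a x) \<and> (\<forall>x. x \<notin> UNIV \<longrightarrow> B x = 0)"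
    then obtain b' where b': "B = blinfun_apply b'" "commute_op ii_op b'"
      using bounded_op_on_UNIV_obtain by (metis positive_on_def)
    then have "pos_op b'" using B pos_op_of_positive_on_UNIV by metis
    moreover have "a x = b' (b' x)" for x using B by (simp add: b'(1))
    then have "commute_op b' b" by (intro b(3)) (simp add: commute_op_def)
    ultimately have "b' = b"
      using B b(1,2) by (intro pos_op_sqrt_unique) (auto simp: b'(1))
    then show "B = blinfun_apply b" by (simp add: b'(1))
  qed
  with b ib that show ?thesis by blast
qed

lemma pos_op_adjoint_compose:
  assumes "is_adjoint t s"
  shows "pos_op (s o\<^sub>L t)"
proof -
  have t: "t x \<bullet>\<^sub>R y = x \<bullet>\<^sub>R s y" and s: "s x \<bullet>\<^sub>R y = x \<bullet>\<^sub>R t y" for x y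
    using assms by (metis is_adjoint_def rinner_commute)+
  have "0 \<le> s (t x) \<bullet>\<^sub>R x" for x unfolding s rinner_self by simp
  then show ?thesis by (auto simp: pos_op_def s t intro!: sym_opI)
qed

lemma abs_on_UNIV_blinfun:
  assumes "is_adjoint t s" "commute_op ii_op t"
  obtains p where "abs_on UNIV (blinfun_apply t) = blinfun_apply p" "pos_op p"
    "commute_op ii_op p" "\<And>x. p (p x) = s (t x)"
proof -
  have "commute_op ii_op (s o\<^sub>L t)"
    using assms(2) adjoint_commutes_ii_op[OF assms] by (simp add: commute_op_def)
  moreover have "abs_on UNIV (blinfun_apply t) = sqrt_on UNIV (blinfun_apply (s o\<^sub>L t))"
    by (simp add: abs_on_def adjoint_on_UNIV_blinfun[OF assms] blinfun_apply_blinfun_compose[abs_def])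
  ultimately show ?thesis
    using sqrt_on_UNIV_blinfun[OF pos_op_adjoint_compose[OF assms(1)]] that by auto
qed

theorem self_adjoint_if_abs_le_abs_Re:
  assumes T: "bounded_op_on UNIV T"
    and le: "loewner_le_on UNIV (abs_on UNIV T) (abs_on UNIV (Re_on UNIV T))"
  obtains t where "T = blinfun_apply t" "sym_op t" "commute_op ii_op t"
proof -
  obtain t where t: "T = blinfun_apply t" "commute_op ii_op t"
    using bounded_op_on_UNIV_obtain[OF T] .
  obtain s where s: "is_adjoint t s" using is_adjoint_exists .
  have si: "commute_op ii_op s" by (rule adjoint_commutes_ii_op[OF s t(2)])
  have st: "s x \<bullet>\<^sub>R y = x \<bullet>\<^sub>R t y" and ts: "t x \<bullet>\<^sub>R y = x \<bullet>\<^sub>R s y" for x y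
    using s by (metis is_adjoint_def rinner_commute)+
  \<comment> \<open>Cartesian decomposition, with \<i> Im T kept as the skew operator
    \<open>B\<close> so that the real theory applies.\<close>
  define A where "A = (1/2) *\<^sub>R (t + s)"
  define B where "B = (1/2) *\<^sub>R (t - s)"
  have A: "sym_op A" by (rule sym_opI) (simp add: A_def blinfun.bilinear_simps rinner_simps st ts)
  have B: "skew_op B" by (rule skew_opI) (simp add: B_def blinfun.bilinear_simps rinner_simps st ts diff_divide_distrib)
  have iA: "commute_op ii_op A" using t(2) si by (simp add: A_def commute_op_def blinfun.bilinear_simps)
  have Re: "Re_on UNIV T = blinfun_apply A"
    by (rule ext) (simp add: Re_on_def A_def t(1) adjoint_on_UNIV_blinfun[OF s t(2)] blinfun.bilinear_simps)
  obtain p where p: "abs_on UNIV T = blinfun_apply p" "pos_op p" "commute_op ii_op p" "\<And>x. p (p x) = s (t x)"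
    using abs_on_UNIV_blinfun[OF s t(2)] unfolding t(1) by blast
  obtain c where c: "abs_on UNIV (Re_on UNIV T) = blinfun_apply c" "pos_op c" "commute_op ii_op c" "\<And>x. c (c x) = A (A x)"
    using abs_on_UNIV_blinfun[OF A[unfolded sym_op_def] iA] unfolding Re by blast
  have AB: "A + B = t" "A - B = s"
    unfolding A_def B_def
    by (simp_all add: scaleR_half_double diff_add_eq flip: scaleR_add_right scaleR_diff_right)
  have "B = 0"
  proof (rule skew_part_vanishes[OF A B c(2,4) p(2)])
    show "p (p x) = (A - B) ((A + B) x)" for x by (simp add: AB p(4))
    show "pos_op (c - p)"
    proof (rule pos_op_of_positive_on_UNIV)
      show "positive_on UNIV (blinfun_apply (c - p))"
        using le unfolding loewner_le_on_def p(1) c(1) by (simp add: blinfun.diff_left[abs_def])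
      show "commute_op ii_op (c - p)"
        using c(3) p(3) by (simp add: commute_op_def blinfun.bilinear_simps)
    qed
  qed
  then have "t = A" using AB by simp
  with A t that show ?thesis by blast
qed

section \<open>Closed complex subspaces, operators on them, and contractions\<close>

lemma closed_csubspace_imp_subspace:
  assumes "closed_csubspace S"
  shows "subspace S" "closed S" "\<And>x. x \<in> S \<Longrightarrow> ii_op x \<in> S"
  using assms by (auto simp: closed_csubspace_def subspace_def scaleR_scaleC ii_op.rep_eq)

lemma ortho_altdef: "ortho S = {y. \<forall>x\<in>S. x \<bullet>\<^sub>R y = 0 \<and> x \<bullet>\<^sub>R ii_op y = 0}"
  by (simp add: ortho_def cinner_eq_0_iff)

lemma closed_csubspace_ortho: "closed_csubspace (ortho S)"
  unfolding closed_csubspace_def ortho_altdef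
proof (intro conjI ballI allI)
  show "closed {y. \<forall>x\<in>S. x \<bullet>\<^sub>R y = 0 \<and> x \<bullet>\<^sub>R ii_op y = 0}"
  proof -
    have "{y. \<forall>x\<in>S. x \<bullet>\<^sub>R y = 0 \<and> x \<bullet>\<^sub>R ii_op y = 0}
        = (\<Inter>x\<in>S. {y. x \<bullet>\<^sub>R y = 0} \<inter> {y. x \<bullet>\<^sub>R ii_op y = 0})"
      by auto
    also have "closed \<dots>"
      by (intro closed_INT ballI closed_Int closed_Collect_eq rinner.continuous_on
          blinfun.continuous_on continuous_on_const continuous_on_id)
    finally show ?thesis .
  qed
qed (auto simp: scaleC_conv_ii_op blinfun.bilinear_simps rinner_simps ii_op_ii_op)

lemma orthogonal_direct_sum_ortho:
  assumes "closed_csubspace S"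
  shows "orthogonal_direct_sum UNIV S (ortho S)"
proof -
  note S = closed_csubspace_imp_subspace[OF assms]
  obtain F where F: "sym_op F" "\<And>x. F x \<in> S" "\<And>x. x \<in> S \<Longrightarrow> F x = x"
    using projection_exists[OF S(1,2)] by metis
  have perp: "x \<bullet>\<^sub>R (y - F y) = 0" if "x \<in> S" for x y
    using sym_opD[OF F(1), of x y] F(3)[OF that] by (simp add: rinner_simps)
  have "x \<bullet>\<^sub>R ii_op (y - F y) = 0" if "x \<in> S" for x y
    using skew_opD[OF skew_ii_op, of x "y - F y"] perp[OF S(3)[OF that], of y] by simp
  with perp have "y - F y \<in> ortho S" for y by (simp add: ortho_altdef)
  then have "y \<in> {a + b | a b. a \<in> S \<and> b \<in> ortho S}" for y
    using F(2)[of y] by (intro CollectI exI[of _ "F y"] exI[of _ "y - F y"]) simp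
  then show ?thesis by (auto simp: orthogonal_direct_sum_def ortho_def)
qed

lemma adjoint_on_invariant:
  assumes "sym_op t" "commute_op ii_op t" "closed_csubspace S" "\<And>x. x \<in> S \<Longrightarrow> t x \<in> S" "y \<in> S"
  shows "adjoint_on S (blinfun_apply t) y = t y"
  using assms(3-5)
  by (intro adjoint_on_eqI) (simp_all add: cinner_eq_iff sym_opD[OF assms(1)] commute_opD[OF assms(2)])

lemma abs_on_Re_on_invariant:
  assumes "sym_op t" "commute_op ii_op t" "closed_csubspace S" "\<And>x. x \<in> S \<Longrightarrow> t x \<in> S"
  shows "abs_on S (Re_on S (blinfun_apply t)) = abs_on S (blinfun_apply t)"
proof -
  have Re: "Re_on S t x = t x" if "x \<in> S" for x
    using adjoint_on_invariant[OF assms that] by (simp add: Re_on_def flip: scaleR_2)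
  \<comment> \<open>The real part and \<open>t\<close> may differ outside \<open>S\<close>, but
    \<open>adjoint_on\<close> and \<open>sqrt_on\<close> see their operator argument only on
    \<open>S\<close>.\<close>
  then have "adjoint_on S (Re_on S t) y = adjoint_on S t y" for y
    unfolding adjoint_on_def by (metis (no_types, lifting))
  then have "adjoint_on S (Re_on S t) (Re_on S t x) = adjoint_on S t (t x)" if "x \<in> S" for x
    using Re[OF that] by simp
  then show ?thesis unfolding abs_on_def sqrt_on_def by (metis (no_types, lifting))
qed

lemma contraction_on_UNIV_norm_le:
  assumes "contraction_on UNIV T"
  shows "norm (T x) \<le> norm x"
proof (cases "x = 0")
  case True
  then show ?thesis
    using assms bounded_op_on_UNIV_obtain[of T] by (metis contraction_on_def blinfun.zero_right norm_zero order_refl)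
next
  case False
  obtain K where K: "\<And>x. norm (T x) \<le> K * norm x"
    using assms by (auto simp: contraction_on_def bounded_op_on_def)
  \<comment> \<open>The supremum in \<open>onorm_on\<close> is an upper bound only once boundedness
    is known.\<close>
  have "bdd_above (range (\<lambda>x. norm (T x) / norm x))"
  proof (rule bdd_aboveI2)
    show "norm (T x) / norm x \<le> \<bar>K\<bar>" for x
      using K[of x] by (cases "x = 0") (auto simp: divide_le_eq intro: order_trans[OF _ mult_right_mono])
  qed
  then have "norm (T x) / norm x \<le> onorm_on UNIV T"
    unfolding onorm_on_def by (rule cSUP_upper[OF UNIV_I])
  also have "\<dots> \<le> 1" using assms by (simp add: contraction_on_def)
  finally show ?thesis using False by (simp add: divide_le_eq)
qed

lemma contraction_onI:
  assumes "bounded_op_on S T" "S \<noteq> {}" "\<And>x. x \<in> S \<Longrightarrow> norm (T x) \<le> norm x"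
  shows "contraction_on S T"
  unfolding contraction_on_def onorm_on_def
  using assms by (auto intro!: cSUP_least simp: divide_le_eq_1)

lemma positive_on_zero:
  assumes "closed_csubspace S"
  shows "positive_on S (\<lambda>x. 0)"
proof -
  have "cinner 0 x = 0" for x :: 'a by (simp add: cinner_eq_0_iff)
  then show ?thesis
    using assms
    by (auto simp: positive_on_def bounded_op_on_def closed_csubspace_def scaleC_conv_ii_op
        blinfun.bilinear_simps intro!: exI[of _ 0])
qed

section \<open>Null-spaces and orthogonal decomposition\<close>

theorem theorem3p1:
  fixes T :: "'a::chilbert_space \<Rightarrow> 'a"
  assumes "contraction_on UNIV T"
    and "loewner_le_on UNIV (abs_on UNIV T) (abs_on UNIV (Re_on UNIV T))"
  shows
    "null_on UNIV (\<lambda>x. x - adjoint_on UNIV T (T x))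
        = null_on UNIV (\<lambda>x. x - T (adjoint_on UNIV T x)) \<and>
     null_on UNIV (\<lambda>x. x - T (adjoint_on UNIV T x))
        = null_on UNIV (\<lambda>x. x - abs_on UNIV (Re_on UNIV T) x) \<and>
     reduces_to_symmetry (null_on UNIV (\<lambda>x. x - adjoint_on UNIV T (T x))) T \<and>
     null_on UNIV (Re_on UNIV T) = null_on UNIV T \<inter> null_on UNIV (adjoint_on UNIV T) \<and>
     orthogonal_direct_sum (null_on UNIV (adjoint_on UNIV T))
        (null_on UNIV (Re_on UNIV T))
        (null_on (closure (range (adjoint_on UNIV T))) (adjoint_on UNIV T)) \<and>
     (null_on UNIV T = null_on UNIV (Re_on UNIV T) \<longleftrightarrow>
        (\<exists>G U Z. closed_csubspace G \<and> is_op_direct_sum T G U Z \<and> symmetry_on G U \<and>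
           pure_contraction_on (ortho G) Z \<and>
           loewner_le_on (ortho G) (abs_on (ortho G) Z) (abs_on (ortho G) (Re_on (ortho G) Z))))"
proof -
  have "bounded_op_on UNIV T" using assms(1) by (simp add: contraction_on_def)
  then obtain t where t: "T = blinfun_apply t" "sym_op t" "commute_op ii_op t"
    using self_adjoint_if_abs_le_abs_Re assms(2) by blast
  note ts = sym_opD[OF t(2)] and ti = commute_opD[OF t(3)]
  have adj: "adjoint_on UNIV T = T"
    using adjoint_on_UNIV_blinfun[OF t(2)[unfolded sym_op_def] t(3)] by (simp add: t(1))
  have Re: "Re_on UNIV T = T" by (rule ext) (simp add: Re_on_def adj flip: scaleR_2)
  obtain c where c: "abs_on UNIV T = blinfun_apply c" "pos_op c" "\<And>x. c (c x) = T (T x)"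
    using abs_on_UNIV_blinfun[OF t(2)[unfolded sym_op_def] t(3)] unfolding t(1) by metis
  have T_le: "norm (T x) \<le> norm x" for x by (rule contraction_on_UNIV_norm_le[OF assms(1)])

  define G where "G = null_on UNIV (\<lambda>x. x - T (T x))"
  have G: "x \<in> G \<longleftrightarrow> T (T x) = x" for x by (auto simp: G_def null_on_def)
  have G_abs: "G = null_on UNIV (\<lambda>x. x - abs_on UNIV T x)"
  proof -
    have "T (T x) = x \<longleftrightarrow> c x = x" for x
    proof
      assume x: "T (T x) = x"
      \<comment> \<open>A nonzero \<open>z\<close> would be an eigenvector of the positive operator
        \<open>c\<close> for the eigenvalue -1.\<close>
      define z where "z = c x - x"
      have "c z = - z" by (simp add: z_def blinfun.bilinear_simps c(3) x)
      then have "(norm z)\<^sup>2 \<le> 0" using pos_opD[OF c(2), of z] by (simp add: rinner_simps rinner_self)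
      then show "c x = x" by (simp add: z_def)
    qed (metis c(3))
    then have "x = T (T x) \<longleftrightarrow> x = c x" for x by metis
    then show ?thesis by (simp add: G_def null_on_def c(1))
  qed
  have G_inv: "T x \<in> G" if "x \<in> G" for x using that by (simp add: G)
  have G_cs: "closed_csubspace G"
    unfolding closed_csubspace_def
  proof (intro conjI ballI allI)
    have "G = {x. t (t x) = x}" by (auto simp: G t(1))
    also have "closed \<dots>"
      by (intro closed_Collect_eq blinfun.continuous_on continuous_on_const continuous_on_id)
    finally show "closed G" .
  qed (auto simp: G t(1) blinfun.bilinear_simps scaleC_conv_ii_op simp flip: ti)
  have adj_G: "adjoint_on G T x = T x" if "x \<in> G" for x
    using adjoint_on_invariant[OF t(2,3) G_cs] G_inv that unfolding t(1) by blast
  have sym_G: "symmetry_on G T"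
    using bounded_op_on_blinfun[OF t(3), of G] G_inv adj_G
    by (simp add: symmetry_on_def unitary_on_def t(1) G)
  have red: "reduces_to_symmetry G T"
    using G_cs G_inv sym_G by (auto simp: reduces_to_symmetry_def adj)

  \<comment> \<open>As Re T = T, the left side of the equivalence holds, so it remains to exhibit a
    decomposition: \<open>T\<close> itself serves as \<open>U\<close> on \<open>G\<close> and as
    \<open>Z\<close> on \<open>H\<close>.\<close>
  define H where "H = ortho G"
  have H_cs: "closed_csubspace H" unfolding H_def by (rule closed_csubspace_ortho)
  have H_inv: "t y \<in> H" if "y \<in> H" for y
    using that G_inv by (simp add: H_def ortho_altdef t(1) ti flip: ts)
  have GH: "x = 0" if "x \<in> G" "x \<in> H" for x
    using that by (auto simp: H_def ortho_altdef rinner_self)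
  have H_bd: "bounded_op_on H T" unfolding t(1) by (rule bounded_op_on_blinfun[OF t(3) H_inv])
  have "norm (T x) < norm x" if x: "x \<in> H" "x \<noteq> 0" for x
  proof (rule ccontr)
    assume "\<not> norm (T x) < norm x"
    with T_le[of x] have eq: "norm (T x) = norm x" by simp
    \<comment> \<open>Equality of norms gives |x - T^2 x|^2 = |T^2 x|^2 - |x|^2 \<le> 0, so
      \<open>x\<close> lies in both \<open>G\<close> and its complement.\<close>
    have "x \<bullet>\<^sub>R T (T x) = (norm x)\<^sup>2" using ts[of x "t x"] eq by (simp add: t(1) rinner_self)
    then have "(norm (x - T (T x)))\<^sup>2 = (norm (T (T x)))\<^sup>2 - (norm x)\<^sup>2" by (simp add: norm_diff_sq)
    also have "\<dots> \<le> 0" using T_le[of "T x"] eq by (simp add: power_mono)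
    finally have "x \<in> G" by (simp add: G)
    with GH x show False by blast
  qed
  moreover have "contraction_on H T"
    using H_cs T_le H_bd by (intro contraction_onI) (auto simp: closed_csubspace_def)
  ultimately have pure: "pure_contraction_on H T" by (simp add: pure_contraction_on_def)
  have "abs_on H (Re_on H T) = abs_on H T"
    unfolding t(1) by (rule abs_on_Re_on_invariant[OF t(2,3) H_cs]) (rule H_inv)
  then have "loewner_le_on H (abs_on H T) (abs_on H (Re_on H T))"
    using positive_on_zero[OF H_cs] by (simp add: loewner_le_on_def)
  moreover have "is_op_direct_sum T G T T"
    using orthogonal_direct_sum_ortho[OF G_cs] by (simp add: is_op_direct_sum_def t(1) blinfun.bilinear_simps)
  ultimately have dec: "\<exists>G U Z. closed_csubspace G \<and> is_op_direct_sum T G U Z \<and> symmetry_on G U \<and>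
      pure_contraction_on (ortho G) Z \<and>
      loewner_le_on (ortho G) (abs_on (ortho G) Z) (abs_on (ortho G) (Re_on (ortho G) Z))"
    using G_cs sym_G pure unfolding H_def by blast

  \<comment> \<open>The kernel of the self-adjoint \<open>T\<close> is orthogonal to the closure of
    its range, so the second summand in the decomposition of the null-space is {0}.\<close>
  have "x = 0" if x: "x \<in> closure (range T)" "T x = 0" for x
  proof -
    have "range T \<subseteq> {y. y \<bullet>\<^sub>R x = 0}" using x(2) by (auto simp: t(1) ts)
    moreover have "closed {y. y \<bullet>\<^sub>R x = 0}"
      by (intro closed_Collect_eq rinner.continuous_on continuous_on_const continuous_on_id)
    ultimately have "x \<bullet>\<^sub>R x = 0" using x(1) closure_minimal by blast
    then show ?thesis by (simp add: rinner_self)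
  qed
  moreover have "0 \<in> closure (range T)"
    using closure_subset[of "range T"] by (metis blinfun.zero_right rangeI subsetD t(1))
  ultimately have "null_on (closure (range T)) T = {0}"
    by (auto simp: null_on_def t(1) blinfun.bilinear_simps)
  then have "orthogonal_direct_sum (null_on UNIV T) (null_on UNIV T) (null_on (closure (range T)) T)"
    by (auto simp: orthogonal_direct_sum_def cinner_eq_0_iff blinfun.bilinear_simps)
  with red G_abs dec show ?thesis unfolding adj Re G_def by simp
qed

end
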